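(* Fix an integer $d\ge 1$. For each $n\ge 1$ let $G_n=(D_n,S_n,E_n)$ be a network with rate functions $\lambda_n:D_n\to(0,\infty)$ and $\mu_n:S_n\to(0,\infty)$, and let $\boldsymbol{X}_n$ be the process of server occupancies when all dispatchers use the power-of-$d$ scheme. Suppose that there is a sequence of servers $\{u_n\in S_n:n\ge 1\}$ with a skewed neighborhood, i.e., there is a fixed $\alpha=(a,\lambda_{\min},\mu_{\max})\in\mathbb{N}\times(0,\infty)\times(0,\infty)$ such that $\lim_{n\to\infty}|\mathcal{N}_n^\alpha(u_n)|=\infty$. Then $$\lim_{n\to\infty}\liminf_{t\to\infty}P\left(\boldsymbol{X}_n(t,u_n)\ge k\right)=1\quad\text{for all } k\in\mathbb{N}.$$
   Context: $\mathbb{N}=\{0,1,2,\dots\}$. A network is a bipartite graph $G=(D,S,E)$ with finite sets $D$ (dispatchers) and $S$ (servers) and $E\subset D\times S$; dispatcher $e$ and server $u$ are compatible if $(e,u)\in E$. Power-of-$d$ scheme: dispatcher $e$ receives tasks as an independent Poisson process of rate $\lambda(e)$. When a task arrives at $e$, the dispatcher samples $d$ compatible servers uniformly at random (without replacement; all compatible servers if there are fewer than $d$) and sends the task to a sampled server with the least number of tasks, ties being broken uniformly at random. Each server $u$ executes tasks sequentially with independent exponential service times of rate $\mu(u)$. $\boldsymbol{X}(t,u)$ is the number of tasks in server $u$ at time $t$; $\boldsymbol{X}$ is a continuous-time Markov chain on $\mathbb{N}^S$. No ergodicity and no particular initial distribution is assumed. For a network $G_n$: $\mathcal{N}_n(e)=\{v\in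 S_n:(e,v)\in E_n\}$ for $e\in D_n$, $\mathcal{N}_n(u)=\{e\in D_n:(e,u)\in E_n\}$ for $u\in S_n$, and $\deg_n(e)=|\mathcal{N}_n(e)|$. For $\alpha=(a,\lambda_{\min},\mu_{\max})$ and $u\in S_n$, $$\mathcal{N}_n^\alpha(u)=\{e\in\mathcal{N}_n(u):\deg_n(e)\le a,\ \lambda_n(e)\ge\lambda_{\min}\text{ and }\mu_n(v)\le\mu_{\max}\text{ for all }v\in\mathcal{N}_n(e)\}.$$ *)

theory Defs
  imports "HOL-Probability.Probability"
begin

definition network :: "'d set \<Rightarrow> 's set \<Rightarrow> ('d \<times> 's) set \<Rightarrow> bool" where
  "network D S E \<longleftrightarrow> finite D \<and> finite S \<and> E \<subseteq> D \<times> S"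

definition servers_of :: "('d \<times> 's) set \<Rightarrow> 'd \<Rightarrow> 's set" where
  "servers_of E e = {v. (e, v) \<in> E}"

definition dispatchers_of :: "('d \<times> 's) set \<Rightarrow> 's \<Rightarrow> 'd set" where
  "dispatchers_of E u = {e. (e, u) \<in> E}"

definition skewed_dispatchers_of ::
  "('d \<times> 's) set \<Rightarrow> ('d \<Rightarrow> real) \<Rightarrow> ('s \<Rightarrow> real) \<Rightarrow> nat \<Rightarrow> real \<Rightarrow> real \<Rightarrow> 's \<Rightarrow> 'd set" where
  "skewed_dispatchers_of E lam mu a lmin mmax u =
     {e \<in> dispatchers_of E u. card (servers_of E e) \<le> a \<and> lam e \<ge> lmin \<and>
        (\<forall>v \<in> servers_of E e. mu v \<le> mmax)}"

text \<open>The server that receives a task arriving, in occupancy state \<open>x\<close>, at a dispatcher whose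
  set of compatible servers is \<open>N\<close>. This is only meaningful for finite nonempty \<open>N\<close> and
  \<open>d \<ge> 1\<close>.\<close>

definition power_of_d :: "nat \<Rightarrow> 's set \<Rightarrow> ('s \<Rightarrow> nat) \<Rightarrow> 's pmf" where
  "power_of_d d N x =
     bind_pmf (pmf_of_set {A. A \<subseteq> N \<and> card A = min d (card N)})
       (\<lambda>A. pmf_of_set {v \<in> A. \<forall>w \<in> A. x v \<le> x w})"

text \<open>The rate of jumping from \<open>x\<close> to a state \<open>y \<noteq> x\<close>. Tasks arriving at a dispatcher without
  compatible servers do not affect the occupancies.\<close>

definition occupancy_rate ::
  "nat \<Rightarrow> 'd set \<Rightarrow> 's set \<Rightarrow> ('d \<times> 's) set \<Rightarrow> ('d \<Rightarrow> real) \<Rightarrow> ('s \<Rightarrow> real) \<Rightarrow>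
   ('s \<Rightarrow> nat) \<Rightarrow> ('s \<Rightarrow> nat) \<Rightarrow> real" where
  "occupancy_rate d D S E lam mu x y =
     (\<Sum>e \<in> {e \<in> D. servers_of E e \<noteq> {}}.
        lam e * pmf (map_pmf (\<lambda>u. x(u := x u + 1)) (power_of_d d (servers_of E e) x)) y) +
     (\<Sum>u \<in> {u \<in> S. x u > 0}. if y = x(u := x u - 1) then mu u else 0)"

text \<open>Time-homogeneous transition functions on a (discrete) state space \<open>I\<close>.\<close>

definition transition_function :: "'x set \<Rightarrow> (real \<Rightarrow> 'x \<Rightarrow> 'x pmf) \<Rightarrow> bool" where
  "transition_function I P \<longleftrightarrow>
     (\<forall>x \<in> I. P 0 x = return_pmf x) \<and>
     (\<forall>t \<ge> 0. \<forall>x \<in> I. set_pmf (P t x) \<subseteq> I) \<and>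
     (\<forall>s \<ge> 0. \<forall>t \<ge> 0. \<forall>x \<in> I. P (s + t) x = bind_pmf (P s x) (P t))"

text \<open>The right derivative at time \<open>0\<close> is the conservative generator with off-diagonal entries
  \<open>q\<close>; the diagonal of \<open>q\<close> itself is ignored.\<close>

definition has_transition_rates ::
  "'x set \<Rightarrow> (real \<Rightarrow> 'x \<Rightarrow> 'x pmf) \<Rightarrow> ('x \<Rightarrow> 'x \<Rightarrow> real) \<Rightarrow> bool" where
  "has_transition_rates I P q \<longleftrightarrow>
     (\<forall>x \<in> I. \<forall>y \<in> I - {x}. ((\<lambda>h. pmf (P h x) y / h) \<longlongrightarrow> q x y) (at_right 0)) \<and>
     (\<forall>x \<in> I. ((\<lambda>h. (1 - pmf (P h x) x) / h) \<longlongrightarrow> (\<Sum>\<^sub>\<infinity>y \<in> I - {x}. q x y)) (at_right 0))"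

text \<open>\<open>X\<close> is a continuous-time Markov chain on \<open>I\<close> with jump rates \<open>q\<close>, with an arbitrary initial
  distribution and almost surely right-continuous paths (for the discrete topology on \<open>I\<close>).
  The past is observed at finitely many times \<open>J\<close>; the states seen then are given by \<open>x\<close>.\<close>

definition markov_chain ::
  "'x set \<Rightarrow> ('x \<Rightarrow> 'x \<Rightarrow> real) \<Rightarrow> 'w measure \<Rightarrow> (real \<Rightarrow> 'w \<Rightarrow> 'x) \<Rightarrow> bool" where
  "markov_chain I q M X \<longleftrightarrow>
     prob_space M \<and>
     (\<forall>t \<ge> 0. X t \<in> measurable M (count_space I)) \<and>
     (AE \<omega> in M. \<forall>t \<ge> 0. eventually (\<lambda>s. X s \<omega> = X t \<omega>) (at_right t)) \<and>
     (\<exists>P. transition_function I P \<and> has_transition_rates I P q \<and>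
        (\<forall>s \<ge> 0. \<forall>t \<ge> 0. \<forall>J x. \<forall>y \<in> I. finite J \<longrightarrow> J \<subseteq> {0..s} \<longrightarrow> s \<in> J \<longrightarrow>
           \<P>(\<omega> in M. \<forall>r \<in> J. X r \<omega> = x r) > 0 \<longrightarrow>
           \<P>(\<omega> in M. X (s + t) \<omega> = y \<bar> \<forall>r \<in> J. X r \<omega> = x r) = pmf (P t (x s)) y))"

text \<open>States in \<open>\<nat>\<^sup>S\<close> are functions that are \<open>undefined\<close> outside \<open>S\<close>.\<close>

definition power_of_d_occupancy ::
  "nat \<Rightarrow> 'd set \<Rightarrow> 's set \<Rightarrow> ('d \<times> 's) set \<Rightarrow> ('d \<Rightarrow> real) \<Rightarrow> ('s \<Rightarrow> real) \<Rightarrow>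
   'w measure \<Rightarrow> (real \<Rightarrow> 'w \<Rightarrow> 's \<Rightarrow> nat) \<Rightarrow> bool" where
  "power_of_d_occupancy d D S E lam mu M X \<longleftrightarrow>
     markov_chain (S \<rightarrow>\<^sub>E UNIV) (occupancy_rate d D S E lam mu) M X"

end

theory Submission
  imports Defs
begin

text \<open>
  By the sunflower lemma, many dispatchers near the server \<open>u\<close> contain \<open>m\<close> dispatchers whose server
  sets have the form core plus petal, with a common core containing \<open>u\<close>, pairwise disjoint petals,
  and \<open>m\<close> large. One shows by induction on \<open>l\<close> that in the long run all core servers hold at least \<open>l\<close>
  tasks with probability \<open>1 - O(1/m)\<close>. As long as the core is at level \<open>l\<close>, every dispatcher whose
  petal is below level \<open>l\<close> feeds its own petal at a rate bounded below, while tasks leave a petal at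
  a bounded rate; since the petals are disjoint, fluctuations average out and a fixed positive
  fraction of the petals is at level \<open>l\<close>. When a core server then drops to \<open>l\<close>, all these
  dispatchers feed the core, at a total rate proportional to \<open>m\<close>, whereas the core loses tasks at a
  bounded rate. Each step is a drift inequality \<open>L F \<le> - c F + \<delta> + C 1\<^sub>A\<close> for a bounded function
  \<open>F\<close>, which gives \<open>limsup E F \<le> (\<delta> + C limsup P(A)) / c\<close> without any ergodicity.
\<close>

text \<open>A petal cannot be compared with level \<open>l\<close> in one stroke: it may lack up to
  \<open>a * l\<close> tasks, and departures keep hitting petals that are nearly done. So the number
  of petals with deficit at most \<open>j\<close> is bounded below for \<open>j\<close> descending
  from \<open>a * l\<close> to 0. While the core is at level \<open>l\<close> and a positive
  fraction of the petals has deficit at most \<open>j + 1\<close>, each petal with deficit exactly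
  \<open>j + 1\<close> enters the next class at rate at least \<open>r\<close>, and departures can
  only remove petals already in that class, too few to offset this as long as the class is small.
  Each descent shrinks the fraction by the factor \<open>\<kappa>\<close> and adds an error of order
  1/m. Rates elsewhere in the network are uncontrolled. The test functions are therefore
  nonincreasing under arrivals, so that foreign arrivals only help, and depend only on core and
  petal servers, whose service rates are bounded. The total rate of the network varies with n, but
  it enters only interchanges of limit and integral and never a final bound.\<close>

section \<open>Differential inequalities\<close>

text \<open>Continuous induction: with slack \<open>\<epsilon>\<close> the bound holds on a maximal
  initial segment; at its right end the right derivative is strictly below
  \<open>\<epsilon>\<close>, so the segment would extend. Right derivatives are what is at hand,
  because the rates describe the semigroup as time decreases to 0.\<close>

lemma nonincreasing_if_right_derivative_nonpos:
  fixes f g :: "real \<Rightarrow> real"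
  assumes "a \<le> b" and cont: "continuous_on {a..b} f"
    and deriv: "\<And>t. a \<le> t \<Longrightarrow> t < b \<Longrightarrow> (f has_real_derivative g t) (at_right t)"
    and nonpos: "\<And>t. a \<le> t \<Longrightarrow> t < b \<Longrightarrow> g t \<le> 0"
  shows "f b \<le> f a"
proof -
  have main: "f b \<le> f a + \<epsilon> * (b - a)" if \<epsilon>: "\<epsilon> > 0" for \<epsilon>
  proof -
    define A where "A = {t \<in> {a..b}. f t \<le> f a + \<epsilon> * (t - a)}"
    define C where "C = {t \<in> {a..b}. {a..t} \<subseteq> A}"
    have "a \<in> C" using \<open>a \<le> b\<close> by (auto simp: C_def A_def)
    have bdd: "bdd_above C" by (rule bdd_aboveI[of _ b]) (auto simp: C_def)
    define s where "s = Sup C"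
    have sb: "a \<le> s" "s \<le> b"
      using \<open>a \<in> C\<close> bdd by (auto simp: s_def intro!: cSup_upper cSup_least simp: C_def)
    have below: "t \<in> A" if t: "a \<le> t" "t < s" for t
    proof -
      obtain u where "u \<in> C" "t < u"
        using t less_cSup_iff[OF _ bdd, of t] \<open>a \<in> C\<close> unfolding s_def by blast
      then show ?thesis using t by (auto simp: C_def)
    qed
    have "closed A"
    proof -
      have "closed ({a..b} \<inter> (\<lambda>t. f t - (f a + \<epsilon> * (t - a))) -` {..0})"
        by (intro continuous_closed_preimage continuous_intros cont closed_atLeastAtMost closed_atMost)
      also have "{a..b} \<inter> (\<lambda>t. f t - (f a + \<epsilon> * (t - a))) -` {..0} = A"
        by (auto simp: A_def)
      finally show ?thesis .
    qed
    have "s \<in> A"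
    proof (cases "s = a")
      case True
      then show ?thesis using \<open>a \<le> b\<close> by (auto simp: A_def)
    next
      case False
      then have "a < s" using sb by auto
      have "\<forall>\<^sub>F t in at_left s. t \<in> A"
        using \<open>a < s\<close> by (auto intro!: eventually_at_leftI[of a] below)
      then show ?thesis
        by (rule Lim_in_closed_set[OF \<open>closed A\<close> _ _ tendsto_ident_at]) simp
    qed
    have "s = b"
    proof (rule ccontr)
      assume "s \<noteq> b"
      then have "s < b" using sb by auto
      have "((\<lambda>y. (f y - f s) / (y - s)) \<longlongrightarrow> g s) (at_right s)"
        using deriv[of s] sb \<open>s < b\<close> by (simp add: has_field_derivative_iff)
      then have "\<forall>\<^sub>F y in at_right s. (f y - f s) / (y - s) < \<epsilon>"
        using nonpos[of s] sb \<open>s < b\<close> \<epsilon> by (auto intro: order_tendstoD)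
      then obtain b' where b': "s < b'" "\<And>y. s < y \<Longrightarrow> y < b' \<Longrightarrow> (f y - f s) / (y - s) < \<epsilon>"
        by (auto simp: eventually_at_right_field)
      define c where "c = min b ((s + b') / 2)"
      have c: "s < c" "c \<le> b" "c < b'" using \<open>s < b\<close> b'(1) by (auto simp: c_def min_def field_simps)
      have "y \<in> A" if "a \<le> y" "y \<le> c" for y
      proof (cases "y \<le> s")
        case True
        then show ?thesis using below[of y] \<open>s \<in> A\<close> that by (cases "y = s") auto
      next
        case False
        then have "(f y - f s) / (y - s) < \<epsilon>" using b'(2)[of y] c that by auto
        then have "f y - f s \<le> \<epsilon> * (y - s)" using False by (simp add: field_simps)
        then show ?thesis using \<open>s \<in> A\<close> that c by (auto simp: A_def algebra_simps)
      qed
      then have "c \<in> C" using c sb by (auto simp: C_def)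
      then have "c \<le> s" unfolding s_def by (intro cSup_upper bdd)
      then show False using c by auto
    qed
    then show ?thesis using \<open>s \<in> A\<close> by (auto simp: A_def)
  qed
  show ?thesis
  proof (rule field_le_epsilon)
    fix e :: real assume "e > 0"
    then have "f b \<le> f a + e / (b - a + 1) * (b - a)" using \<open>a \<le> b\<close> by (intro main) auto
    also have "e / (b - a + 1) * (b - a) \<le> e"
      using \<open>a \<le> b\<close> \<open>e > 0\<close> by (auto simp: field_simps)
    finally show "f b \<le> f a + e" by simp
  qed
qed

text \<open>This says that \<open>limsup p \<le> q\<close> at infinity.\<close>

definition ultimately_le :: "(real \<Rightarrow> real) \<Rightarrow> real \<Rightarrow> bool" where
  "ultimately_le p q \<longleftrightarrow> (\<forall>\<epsilon>>0. \<forall>\<^sub>F t in at_top. p t \<le> q + \<epsilon>)"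

lemma ultimately_le_mono:
  assumes "ultimately_le p q" "\<And>t. t \<ge> 0 \<Longrightarrow> p' t \<le> p t" "q \<le> q'"
  shows "ultimately_le p' q'"
  unfolding ultimately_le_def
proof safe
  fix \<epsilon> :: real assume "\<epsilon> > 0"
  then have "\<forall>\<^sub>F t in at_top. p t \<le> q + \<epsilon>" using assms(1) by (auto simp: ultimately_le_def)
  then show "\<forall>\<^sub>F t in at_top. p' t \<le> q' + \<epsilon>"
    using eventually_ge_at_top[of 0]
    by eventually_elim (use assms(2,3) in force)
qed

lemma ultimately_le_cmult:
  assumes "ultimately_le p q" "c > 0"
  shows "ultimately_le (\<lambda>t. c * p t) (c * q)"
  unfolding ultimately_le_def
proof safe
  fix \<epsilon> :: real assume "\<epsilon> > 0"
  then have "\<forall>\<^sub>F t in at_top. p t \<le> q + \<epsilon> / c" using assms by (auto simp: ultimately_le_def)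
  then show "\<forall>\<^sub>F t in at_top. c * p t \<le> c * q + \<epsilon>"
    by eventually_elim (use assms(2) in \<open>simp add: field_simps\<close>)
qed

lemma ultimately_le_add:
  assumes "ultimately_le p q" "ultimately_le p' q'"
  shows "ultimately_le (\<lambda>t. p t + p' t) (q + q')"
  unfolding ultimately_le_def
proof safe
  fix \<epsilon> :: real assume "\<epsilon> > 0"
  then have "\<forall>\<^sub>F t in at_top. p t \<le> q + \<epsilon>/2" "\<forall>\<^sub>F t in at_top. p' t \<le> q' + \<epsilon>/2"
    using assms by (auto simp: ultimately_le_def)
  then show "\<forall>\<^sub>F t in at_top. p t + p' t \<le> q + q' + \<epsilon>"
    by eventually_elim linarith
qed

text \<open>Gronwall argument: once \<open>p\<close> stays below \<open>q + \<eta>\<close>, the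
  function \<open>exp (c * t) * (\<phi> t - K)\<close> is nonincreasing, where \<open>K\<close> is
  the equilibrium of the comparison equation.\<close>

lemma ultimately_le_of_differential_inequality:
  fixes \<phi> \<phi>' p :: "real \<Rightarrow> real"
  assumes c: "c > 0" and C: "C \<ge> 0"
    and cont: "continuous_on {0..} \<phi>"
    and deriv: "\<And>t. t \<ge> 0 \<Longrightarrow> (\<phi> has_real_derivative \<phi>' t) (at_right t)"
    and le: "\<And>t. t \<ge> 0 \<Longrightarrow> \<phi>' t \<le> - c * \<phi> t + \<delta> + C * p t"
    and p: "ultimately_le p q"
  shows "ultimately_le \<phi> ((\<delta> + C * q) / c)"
  unfolding ultimately_le_def
proof safe
  fix \<epsilon> :: real assume \<epsilon>: "\<epsilon> > 0"
  \<comment> \<open>Makes \<open>C * \<eta> / c\<close> at most \<open>\<epsilon> / 2\<close>, also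
    when \<open>C = 0\<close>; the other half absorbs the decaying exponential.\<close>
  define \<eta> where "\<eta> = \<epsilon> * c / (2 * (C + 1))"
  have \<eta>: "\<eta> > 0" using \<epsilon> c C by (simp add: \<eta>_def)
  define K where "K = (\<delta> + C * (q + \<eta>)) / c"
  have "\<forall>\<^sub>F t in at_top. p t \<le> q + \<eta>" using p \<eta> by (auto simp: ultimately_le_def)
  then obtain T0 where T0: "\<And>t. t \<ge> T0 \<Longrightarrow> p t \<le> q + \<eta>" by (auto simp: eventually_at_top_linorder)
  define T where "T = max T0 0"
  define \<psi> where "\<psi> t = exp (c * t) * (\<phi> t - K)" for t
  have bound: "\<psi> t \<le> \<psi> T" if "t \<ge> T" for t
  proof (rule nonincreasing_if_right_derivative_nonpos[OF that])
    have "continuous_on {T..t} \<phi>" by (rule continuous_on_subset[OF cont]) (auto simp: T_def)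
    then show "continuous_on {T..t} \<psi>" unfolding \<psi>_def by (intro continuous_intros)
  next
    fix s assume s: "T \<le> s" "s < t"
    then have s0: "s \<ge> 0" "s \<ge> T0" by (auto simp: T_def)
    show "(\<psi> has_real_derivative exp (c * s) * (c * (\<phi> s - K) + \<phi>' s)) (at_right s)"
      unfolding \<psi>_def
      by (auto intro!: derivative_eq_intros deriv[OF s0(1)] simp: algebra_simps)
    have "\<phi>' s \<le> - c * \<phi> s + \<delta> + C * (q + \<eta>)"
      using le[OF s0(1)] mult_left_mono[OF T0[OF s0(2)] C] by linarith
    also have "\<dots> = - c * (\<phi> s - K)" using c by (simp add: K_def field_simps)
    finally show "exp (c * s) * (c * (\<phi> s - K) + \<phi>' s) \<le> 0"
      by (simp add: mult_le_0_iff)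
  qed
  have "((\<lambda>t. exp (- c * t)) \<longlongrightarrow> 0) at_top"
    using c by real_asymp
  then have "((\<lambda>t. K + exp (- c * t) * \<psi> T) \<longlongrightarrow> K + 0 * \<psi> T) at_top"
    by (intro tendsto_intros)
  then have "\<forall>\<^sub>F t in at_top. K + exp (- c * t) * \<psi> T < K + \<epsilon> / 2"
    using \<epsilon> by (intro order_tendstoD) auto
  then show "\<forall>\<^sub>F t in at_top. \<phi> t \<le> (\<delta> + C * q) / c + \<epsilon>"
    using eventually_ge_at_top[of T]
  proof eventually_elim
    fix t assume t: "K + exp (- c * t) * \<psi> T < K + \<epsilon> / 2" "T \<le> t"
    have "\<phi> t - K = exp (- c * t) * \<psi> t"
      by (simp add: \<psi>_def mult.assoc[symmetric] exp_add[symmetric])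
    also have "\<dots> \<le> exp (- c * t) * \<psi> T" using bound[OF t(2)] by simp
    finally have "\<phi> t < K + \<epsilon> / 2" using t(1) by linarith
    also have "K = (\<delta> + C * q) / c + C * \<eta> / c" by (simp add: K_def distrib_left add_divide_distrib)
    also have "C * \<eta> / c = \<epsilon> / 2 * (C / (C + 1))" using c by (simp add: \<eta>_def)
    also have "\<dots> \<le> \<epsilon> / 2" using C \<epsilon> by (intro mult_left_le) auto
    finally show "\<phi> t \<le> (\<delta> + C * q) / c + \<epsilon>" by simp
  qed
qed

section \<open>Markov chains with bounded rates\<close>

lemma integral_bind_pmf_bounded:
  fixes F :: "'x \<Rightarrow> real"
  assumes "\<And>y. \<bar>F y\<bar> \<le> B"
  shows "measure_pmf.expectation (bind_pmf p f) F
    = measure_pmf.expectation p (\<lambda>x. measure_pmf.expectation (f x) F)"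
  unfolding measure_pmf_bind
  by (rule integral_bind[where K = "count_space UNIV" and B = B and B' = 1])
    (auto simp: assms measure_pmf.finite_measure measure_pmf_in_subprob_algebra
      measure_pmf.emeasure_space_1[simplified])

lemma integrable_pmf_bounded:
  fixes F :: "'x \<Rightarrow> real"
  assumes "\<And>y. \<bar>F y\<bar> \<le> B"
  shows "integrable (measure_pmf p) F"
  by (rule measure_pmf.integrable_const_bound[where B = B]) (auto simp: assms)

lemma expectation_pmf_le:
  fixes F :: "'x \<Rightarrow> real"
  assumes "\<And>y. \<bar>F y\<bar> \<le> B" "\<And>y. y \<in> set_pmf p \<Longrightarrow> F y \<le> c"
  shows "measure_pmf.expectation p F \<le> c"
proof -
  have "measure_pmf.expectation p F \<le> measure_pmf.expectation p (\<lambda>_. c)"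
    by (intro integral_mono_AE integrable_pmf_bounded[OF assms(1)])
      (auto simp: AE_measure_pmf_iff assms)
  then show ?thesis by simp
qed

lemma expectation_pmf_abs_le:
  fixes F :: "'x \<Rightarrow> real"
  assumes "\<And>y. \<bar>F y\<bar> \<le> B"
  shows "\<bar>measure_pmf.expectation p F\<bar> \<le> B"
  using expectation_pmf_le[of F B p B] expectation_pmf_le[of "\<lambda>y. - F y" B p B] assms
  by (fastforce simp: abs_le_iff)

lemma markov_inequality_pmf:
  fixes F :: "'x \<Rightarrow> real"
  assumes "\<And>y. \<bar>F y\<bar> \<le> B" "\<And>y. F y \<ge> 0" "\<theta> > 0" "\<And>y. y \<in> A \<Longrightarrow> F y \<ge> \<theta>"
  shows "measure_pmf.prob p A \<le> measure_pmf.expectation p F / \<theta>"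
proof -
  have "\<theta> * measure_pmf.prob p A = measure_pmf.expectation p (\<lambda>y. \<theta> * indicator A y)" by simp
  also have "\<dots> \<le> measure_pmf.expectation p F"
    using assms
    by (intro integral_mono integrable_pmf_bounded[where F = F, OF assms(1)] integrable_pmf_bounded[of _ \<theta>])
      (auto simp: indicator_def)
  finally show ?thesis using assms by (simp add: field_simps)
qed

text \<open>\<open>\<Lambda>\<close> dominates difference quotients, which makes the forward
  equation available for every bounded function. It may grow with the network, since it does not
  occur in the conclusion of \<open>lyapunov_bound\<close>.\<close>

locale bounded_rates_chain =
  fixes I :: "'x set" and P :: "real \<Rightarrow> 'x \<Rightarrow> 'x pmf" and q :: "'x \<Rightarrow> 'x \<Rightarrow> real"
    and succs :: "'x \<Rightarrow> 'x set" and \<Lambda> :: real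
  assumes transition: "transition_function I P"
    and rates: "has_transition_rates I P q"
    and finite_succs: "x \<in> I \<Longrightarrow> finite (succs x)"
    and succs_subset: "x \<in> I \<Longrightarrow> succs x \<subseteq> I - {x}"
    and rate_eq_0: "x \<in> I \<Longrightarrow> y \<in> I - {x} - succs x \<Longrightarrow> q x y = 0"
    and exit_rate_le: "x \<in> I \<Longrightarrow> (\<Sum>y\<in>succs x. q x y) \<le> \<Lambda>"
begin

definition generator :: "('x \<Rightarrow> real) \<Rightarrow> 'x \<Rightarrow> real" where
  "generator F x = (\<Sum>y\<in>succs x. q x y * (F y - F x))"

lemma P_0: "x \<in> I \<Longrightarrow> P 0 x = return_pmf x"
  using transition unfolding transition_function_def by blast

lemma set_P_subset: "x \<in> I \<Longrightarrow> t \<ge> 0 \<Longrightarrow> set_pmf (P t x) \<subseteq> I"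
  using transition unfolding transition_function_def by blast

lemma P_add: "x \<in> I \<Longrightarrow> s \<ge> 0 \<Longrightarrow> t \<ge> 0 \<Longrightarrow> P (s + t) x = bind_pmf (P s x) (P t)"
  using transition unfolding transition_function_def by blast

lemma exit_probability_rate:
  assumes "x \<in> I"
  shows "((\<lambda>h. (1 - pmf (P h x) x) / h) \<longlongrightarrow> (\<Sum>y\<in>succs x. q x y)) (at_right 0)"
proof -
  have "(\<Sum>\<^sub>\<infinity>y \<in> I - {x}. q x y) = (\<Sum>\<^sub>\<infinity>y \<in> succs x. q x y)"
    using succs_subset[OF assms] rate_eq_0[OF assms]
    by (intro infsum_cong_neutral) auto
  also have "\<dots> = (\<Sum>y\<in>succs x. q x y)" using finite_succs[OF assms] by simp
  finally show ?thesis using rates assms by (auto simp: has_transition_rates_def)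
qed

text \<open>One way to be at \<open>x\<close> at time \<open>s + t\<close> is to be there at time
  \<open>s\<close> already.\<close>

lemma stay_probability_mult:
  assumes "x \<in> I" "s \<ge> 0" "t \<ge> 0"
  shows "pmf (P s x) x * pmf (P t x) x \<le> pmf (P (s + t) x) x"
proof -
  have "pmf (P s x) x * pmf (P t x) x
    = measure_pmf.expectation (P s x) (\<lambda>y. indicator {x} y * pmf (P t x) x)"
    by (simp add: pmf.rep_eq)
  also have "\<dots> \<le> measure_pmf.expectation (P s x) (\<lambda>y. pmf (P t y) x)"
    by (intro integral_mono integrable_pmf_bounded[where B = 1])
      (auto simp: indicator_def pmf_le_1)
  also have "\<dots> = pmf (P (s + t) x) x"
    using assms by (simp add: P_add pmf_bind)
  finally show ?thesis .
qed

lemma exit_probability_le: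
  assumes "x \<in> I" "h \<ge> 0"
  shows "1 - pmf (P h x) x \<le> \<Lambda> * h"
proof (cases "h = 0")
  case True
  then show ?thesis using assms by (simp add: P_0)
next
  case False
  then have h: "h > 0" using assms by auto
  \<comment> \<open>\<open>g\<close> is subadditive, so \<open>g h / h\<close> is at most its limit at \<open>0\<close>.\<close>
  define g where "g s = 1 - pmf (P s x) x" for s
  have sub: "g (s + t) \<le> g s + g t" if "s \<ge> 0" "t \<ge> 0" for s t
  proof -
    \<comment> \<open>Expanded, this is 1 - p p' \<le> (1 - p) + (1 - p') for the two stay
      probabilities.\<close>
    have "0 \<le> (1 - pmf (P s x) x) * (1 - pmf (P t x) x)"
      by (intro mult_nonneg_nonneg) (auto simp: pmf_le_1)
    then show ?thesis using stay_probability_mult[OF assms(1) that]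
      by (simp add: g_def algebra_simps)
  qed
  have iter: "g (real n * s) \<le> real n * g s" if "s \<ge> 0" for n s
  proof (induction n)
    case 0
    then show ?case using assms by (simp add: P_0 g_def)
  next
    case (Suc n)
    have "g (real (Suc n) * s) = g (real n * s + s)" by (simp add: algebra_simps)
    also have "\<dots> \<le> g (real n * s) + g s" using that by (intro sub) auto
    finally show ?case using Suc by (simp add: algebra_simps)
  qed
  have lim: "filterlim (\<lambda>n. h / real (Suc n)) (at_right 0) sequentially"
    using h by real_asymp
  have "(\<lambda>n. g (h / real (Suc n)) / (h / real (Suc n))) \<longlonglongrightarrow> (\<Sum>y\<in>succs x. q x y)"
    using filterlim_compose[OF exit_probability_rate[OF assms(1)] lim] by (simp add: g_def)
  moreover have "g h / h \<le> g (h / real (Suc n)) / (h / real (Suc n))" for n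
    using iter[of "h / real (Suc n)" "Suc n"] h by (simp add: field_simps del: of_nat_Suc)
  ultimately have "g h / h \<le> (\<Sum>y\<in>succs x. q x y)" by (intro LIMSEQ_le_const) auto
  also have "\<dots> \<le> \<Lambda>" by (rule exit_rate_le[OF assms(1)])
  finally show ?thesis using h by (simp add: g_def field_simps)
qed

text \<open>The increment vanishes if the chain is at \<open>x\<close> at time \<open>h\<close> and
  is at most \<open>2 * B\<close> otherwise. Being uniform in \<open>x\<close> and valid for all
  \<open>h\<close>, the bound yields both a Lipschitz constant in time and an integrable
  majorant.\<close>

lemma expectation_increment_le:
  fixes F :: "'x \<Rightarrow> real"
  assumes F: "\<And>y. \<bar>F y\<bar> \<le> B" and "x \<in> I" "h \<ge> 0"
  shows "\<bar>measure_pmf.expectation (P h x) F - F x\<bar> \<le> 2 * B * \<Lambda> * h"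
proof -
  have B: "B \<ge> 0" using F[of x] by linarith
  have "measure_pmf.expectation (P h x) F - F x
    = measure_pmf.expectation (P h x) (\<lambda>y. F y - F x)"
    using integrable_pmf_bounded[where F = F, OF F] by simp
  also have "\<bar>\<dots>\<bar> \<le> measure_pmf.expectation (P h x) (\<lambda>y. \<bar>F y - F x\<bar>)"
    by (rule integral_abs_bound)
  also have "\<dots> \<le> measure_pmf.expectation (P h x) (\<lambda>y. 2 * B * (1 - indicator {x} y))"
  proof (intro integral_mono integrable_pmf_bounded)
    fix y
    show "\<bar>\<bar>F y - F x\<bar>\<bar> \<le> 2 * B" using F[of x] F[of y] by linarith
    show "\<bar>2 * B * (1 - indicator {x} y)\<bar> \<le> 2 * B" using B by (auto simp: indicator_def)
    show "\<bar>F y - F x\<bar> \<le> 2 * B * (1 - indicator {x} y)"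
      using F[of x] F[of y] B by (auto simp: indicator_def)
  qed
  also have "\<dots> = 2 * B * (1 - pmf (P h x) x)"
    by (subst integral_mult_right_zero, subst Bochner_Integration.integral_diff)
      (auto simp: pmf.rep_eq intro!: integrable_pmf_bounded[where B = 1])
  also have "\<dots> \<le> 2 * B * (\<Lambda> * h)"
    using B by (intro mult_left_mono exit_probability_le assms) auto
  finally show ?thesis by (simp add: mult_ac)
qed

text \<open>The rates are prescribed entry by entry, so convergence of the expectation needs control
  of the remaining mass. The exit probability has as derivative exactly the sum of the rates to
  \<open>succs x\<close>; hence the probability of being neither at \<open>x\<close> nor in
  \<open>succs x\<close> is o(h), which is negligible for bounded \<open>F\<close>.\<close>

lemma generator_rate:
  fixes F :: "'x \<Rightarrow> real"
  assumes F: "\<And>y. \<bar>F y\<bar> \<le> B" and x: "x \<in> I"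
  shows "((\<lambda>h. (measure_pmf.expectation (P h x) F - F x) / h) \<longlongrightarrow> generator F x) (at_right 0)"
proof -
  define T where "T = succs x"
  have T: "finite T" "x \<notin> T" "T \<subseteq> I" using finite_succs[OF x] succs_subset[OF x] by (auto simp: T_def)
  have B: "B \<ge> 0" using F[of x] by linarith
  define main where "main h = (\<Sum>y\<in>T. pmf (P h x) y * (F y - F x))" for h
  define rest where "rest h = 1 - pmf (P h x) x - (\<Sum>y\<in>T. pmf (P h x) y)" for h
  have err: "\<bar>measure_pmf.expectation (P h x) F - F x - main h\<bar> \<le> 2 * B * rest h" for h
  proof -
    define G where "G y = (F y - F x) * indicator T y" for y
    have G: "\<bar>G y\<bar> \<le> 2 * B" for y using F[of x] F[of y] B by (auto simp: G_def indicator_def)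
    have "measure_pmf.expectation (P h x) G = main h"
      unfolding main_def
      by (subst integral_measure_pmf[OF T(1)]) (auto simp: G_def indicator_def split: if_splits)
    then have "measure_pmf.expectation (P h x) F - F x - main h
      = measure_pmf.expectation (P h x) (\<lambda>y. F y - F x - G y)"
      using integrable_pmf_bounded[where F = F, OF F] integrable_pmf_bounded[where F = G, OF G] by simp
    also have "\<bar>\<dots>\<bar> \<le> measure_pmf.expectation (P h x) (\<lambda>y. \<bar>F y - F x - G y\<bar>)"
      by (rule integral_abs_bound)
    also have "\<dots> \<le> measure_pmf.expectation (P h x) (\<lambda>y. 2 * B * (1 - indicator (insert x T) y))"
    proof (intro integral_mono integrable_pmf_bounded)
      fix y
      show "\<bar>\<bar>F y - F x - G y\<bar>\<bar> \<le> 4 * B" using F[of x] F[of y] G[of y] by linarith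
      show "\<bar>2 * B * (1 - indicator (insert x T) y)\<bar> \<le> 2 * B" using B by (auto simp: indicator_def)
      show "\<bar>F y - F x - G y\<bar> \<le> 2 * B * (1 - indicator (insert x T) y)"
        using F[of x] F[of y] B by (auto simp: indicator_def G_def)
    qed
    also have "\<dots> = 2 * B * (1 - measure_pmf.prob (P h x) (insert x T))"
      by (subst integral_mult_right_zero, subst Bochner_Integration.integral_diff)
        (auto intro!: integrable_pmf_bounded[where B = 1])
    also have "measure_pmf.prob (P h x) (insert x T) = pmf (P h x) x + (\<Sum>y\<in>T. pmf (P h x) y)"
      using T by (subst measure_measure_pmf_finite) auto
    finally show ?thesis by (simp add: rest_def algebra_simps)
  qed
  have rate: "((\<lambda>h. pmf (P h x) y / h) \<longlongrightarrow> q x y) (at_right 0)" if "y \<in> T" for y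
    using rates x T that by (auto simp: has_transition_rates_def)
  have "((\<lambda>h. \<Sum>y\<in>T. pmf (P h x) y / h * (F y - F x)) \<longlongrightarrow> generator F x) (at_right 0)"
    unfolding generator_def T_def[symmetric] by (intro tendsto_intros rate)
  then have main: "((\<lambda>h. main h / h) \<longlongrightarrow> generator F x) (at_right 0)"
    by (simp add: main_def sum_divide_distrib)
  have "((\<lambda>h. (1 - pmf (P h x) x) / h - (\<Sum>y\<in>T. pmf (P h x) y / h))
      \<longlongrightarrow> (\<Sum>y\<in>succs x. q x y) - (\<Sum>y\<in>T. q x y)) (at_right 0)"
    by (intro tendsto_intros rate exit_probability_rate x)
  then have "((\<lambda>h. 2 * B * (rest h / h)) \<longlongrightarrow> 2 * B * 0) (at_right 0)"
    by (intro tendsto_intros) (simp add: rest_def sum_divide_distrib diff_divide_distrib T_def)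
  then have rest: "((\<lambda>h. 2 * B * (rest h / h)) \<longlongrightarrow> 0) (at_right 0)" by simp
  have "((\<lambda>h. (measure_pmf.expectation (P h x) F - F x - main h) / h) \<longlongrightarrow> 0) (at_right 0)"
  proof (rule Lim_null_comparison[OF _ rest])
    show "\<forall>\<^sub>F h in at_right 0. norm ((measure_pmf.expectation (P h x) F - F x - main h) / h)
      \<le> 2 * B * (rest h / h)"
      using eventually_at_right_less[of 0]
      by eventually_elim (use err in \<open>simp add: divide_right_mono\<close>)
  qed
  from tendsto_add[OF this main] show ?thesis by (simp add: diff_divide_distrib)
qed

section \<open>The law at time t under an initial distribution\<close>

lemma law_in_states:
  assumes "set_pmf \<nu> \<subseteq> I" "t \<ge> 0" "x \<in> set_pmf (bind_pmf \<nu> (P t))"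
  shows "x \<in> I"
proof -
  obtain y where "y \<in> set_pmf \<nu>" "x \<in> set_pmf (P t y)" using assms(3) by auto
  then show ?thesis using assms(1) set_P_subset[OF _ assms(2)] by blast
qed

lemma expectation_law_add:
  fixes F :: "'x \<Rightarrow> real"
  assumes F: "\<And>y. \<bar>F y\<bar> \<le> B" and \<nu>: "set_pmf \<nu> \<subseteq> I" and "t \<ge> 0" "h \<ge> 0"
  shows "measure_pmf.expectation (bind_pmf \<nu> (P (t + h))) F
    = measure_pmf.expectation (bind_pmf \<nu> (P t)) (\<lambda>x. measure_pmf.expectation (P h x) F)"
proof -
  have "bind_pmf \<nu> (P (t + h)) = bind_pmf \<nu> (\<lambda>x. bind_pmf (P t x) (P h))"
    using \<nu> assms by (intro bind_pmf_cong refl P_add) auto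
  then show ?thesis by (simp add: bind_assoc_pmf[symmetric] integral_bind_pmf_bounded[where F = F, OF F])
qed

lemma expectation_law_increment_le:
  fixes F :: "'x \<Rightarrow> real"
  assumes F: "\<And>y. \<bar>F y\<bar> \<le> B" and \<nu>: "set_pmf \<nu> \<subseteq> I" and "t \<ge> 0" "h \<ge> 0"
  shows "\<bar>measure_pmf.expectation (bind_pmf \<nu> (P (t + h))) F
    - measure_pmf.expectation (bind_pmf \<nu> (P t)) F\<bar> \<le> 2 * B * \<Lambda> * h"
proof -
  let ?G = "\<lambda>x. measure_pmf.expectation (P h x) F"
  have G: "\<bar>?G x\<bar> \<le> B" for x by (rule expectation_pmf_abs_le[where F = F, OF F])
  have "measure_pmf.expectation (bind_pmf \<nu> (P (t + h))) F
    - measure_pmf.expectation (bind_pmf \<nu> (P t)) F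
    = measure_pmf.expectation (bind_pmf \<nu> (P t)) (\<lambda>x. ?G x - F x)"
    using integrable_pmf_bounded[where F = F, OF F] integrable_pmf_bounded[where F = ?G, OF G]
    by (simp add: expectation_law_add[where F = F, OF F \<nu> assms(3,4)])
  also have "\<bar>\<dots>\<bar> \<le> measure_pmf.expectation (bind_pmf \<nu> (P t)) (\<lambda>x. \<bar>?G x - F x\<bar>)"
    by (rule integral_abs_bound)
  also have "\<dots> \<le> 2 * B * \<Lambda> * h"
  proof (rule expectation_pmf_le)
    show "\<bar>\<bar>?G x - F x\<bar>\<bar> \<le> 2 * B" for x using F[of x] G[of x] by linarith
    show "\<bar>?G x - F x\<bar> \<le> 2 * B * \<Lambda> * h" if "x \<in> set_pmf (bind_pmf \<nu> (P t))" for x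
      using law_in_states[OF \<nu> assms(3) that] by (intro expectation_increment_le F assms(4))
  qed
  finally show ?thesis .
qed

lemma continuous_on_expectation_law:
  fixes F :: "'x \<Rightarrow> real"
  assumes F: "\<And>y. \<bar>F y\<bar> \<le> B" and \<nu>: "set_pmf \<nu> \<subseteq> I"
  shows "continuous_on {0..} (\<lambda>t. measure_pmf.expectation (bind_pmf \<nu> (P t)) F)"
proof (rule lipschitz_on_continuous_on)
  define L where "L = \<bar>2 * B * \<Lambda>\<bar>"
  let ?\<phi> = "\<lambda>t. measure_pmf.expectation (bind_pmf \<nu> (P t)) F"
  have *: "dist (?\<phi> s) (?\<phi> t) \<le> L * dist s t" if "0 \<le> s" "s \<le> t" for s t
  proof -
    have "\<bar>?\<phi> (s + (t - s)) - ?\<phi> s\<bar> \<le> 2 * B * \<Lambda> * (t - s)"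
      using that by (intro expectation_law_increment_le F \<nu>) auto
    also have "\<dots> \<le> L * (t - s)" unfolding L_def using that by (intro mult_right_mono) auto
    finally show ?thesis using that by (simp add: dist_real_def abs_minus_commute)
  qed
  show "L-lipschitz_on {0..} ?\<phi>"
  proof (rule lipschitz_onI)
    fix s t :: real assume "s \<in> {0..}" "t \<in> {0..}"
    then show "dist (?\<phi> s) (?\<phi> t) \<le> L * dist s t"
      using *[of s t] *[of t s] by (cases "s \<le> t") (auto simp: dist_commute)
  qed (simp add: L_def)
qed

text \<open>By the semigroup property the quotient at time \<open>t\<close> is an average, over the
  law at time \<open>t\<close>, of quotients at time 0. Dominated convergence with the majorant from
  \<open>expectation_increment_le\<close> passes to the limit.\<close>

lemma expectation_law_right_derivative:
  fixes F :: "'x \<Rightarrow> real"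
  assumes F: "\<And>y. \<bar>F y\<bar> \<le> B" and \<nu>: "set_pmf \<nu> \<subseteq> I" and t: "t \<ge> 0"
  shows "((\<lambda>t. measure_pmf.expectation (bind_pmf \<nu> (P t)) F)
    has_real_derivative measure_pmf.expectation (bind_pmf \<nu> (P t)) (generator F)) (at_right t)"
proof -
  let ?\<phi> = "\<lambda>t. measure_pmf.expectation (bind_pmf \<nu> (P t)) F"
  let ?\<mu> = "bind_pmf \<nu> (P t)"
  have "((\<lambda>h. (?\<phi> (t + h) - ?\<phi> t) / h) \<longlongrightarrow> measure_pmf.expectation ?\<mu> (generator F)) (at_right 0)"
  proof (rule tendsto_at_right_sequentially[of 0 1])
    fix S :: "nat \<Rightarrow> real" assume S: "\<And>n. 0 < S n" "S \<longlonglongrightarrow> 0"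
    have S': "filterlim S (at_right 0) sequentially"
      using S by (auto simp: filterlim_at less_imp_neq[symmetric])
    let ?G = "\<lambda>n x. (measure_pmf.expectation (P (S n) x) F - F x) / S n"
    have "(\<lambda>n. measure_pmf.expectation ?\<mu> (?G n)) \<longlonglongrightarrow> measure_pmf.expectation ?\<mu> (generator F)"
    proof (rule integral_dominated_convergence[where w = "\<lambda>_. 2 * B * \<Lambda>"])
      show "AE x in ?\<mu>. (\<lambda>n. ?G n x) \<longlonglongrightarrow> generator F x"
        using filterlim_compose[OF generator_rate[where F = F, OF F] S'] law_in_states[OF \<nu> t]
        by (auto simp: AE_measure_pmf_iff)
      show "AE x in ?\<mu>. norm (?G n x) \<le> 2 * B * \<Lambda>" for n
        using expectation_increment_le[where F = F, OF F, of _ "S n"] law_in_states[OF \<nu> t] S(1)[of n]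
        by (auto simp: AE_measure_pmf_iff divide_le_eq less_imp_le)
    qed auto
    moreover have "measure_pmf.expectation ?\<mu> (?G n) = (?\<phi> (t + S n) - ?\<phi> t) / S n" for n
      using integrable_pmf_bounded[where F = F, OF F] S(1)[of n]
        integrable_pmf_bounded[of "\<lambda>x. measure_pmf.expectation (P (S n) x) F", OF expectation_pmf_abs_le[where F = F, OF F]]
      by (simp add: expectation_law_add[where F = F, OF F \<nu> t])
    ultimately show "(\<lambda>n. (?\<phi> (t + S n) - ?\<phi> t) / S n)
      \<longlonglongrightarrow> measure_pmf.expectation ?\<mu> (generator F)" by (simp only:)
  qed auto
  then show ?thesis
    by (simp add: has_field_derivative_iff filterlim_at_right_to_0[of _ _ t] add.commute)
qed

lemma lyapunov_bound:
  fixes F :: "'x \<Rightarrow> real"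
  assumes F: "\<And>y. \<bar>F y\<bar> \<le> B" and \<nu>: "set_pmf \<nu> \<subseteq> I" and "c > 0" "C \<ge> 0"
    and drift: "\<And>x. x \<in> I \<Longrightarrow> generator F x \<le> - c * F x + \<delta> + C * indicator A x"
    and A: "ultimately_le (\<lambda>t. measure_pmf.prob (bind_pmf \<nu> (P t)) A) p"
  shows "ultimately_le (\<lambda>t. measure_pmf.expectation (bind_pmf \<nu> (P t)) F) ((\<delta> + C * p) / c)"
proof (rule ultimately_le_of_differential_inequality[OF \<open>c > 0\<close> \<open>C \<ge> 0\<close>
      continuous_on_expectation_law[where F = F, OF F \<nu>] expectation_law_right_derivative[where F = F, OF F \<nu>] _ A])
  fix t :: real assume t: "t \<ge> 0"
  let ?\<mu> = "bind_pmf \<nu> (P t)"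
  \<comment> \<open>The bound survives the limit of the difference quotients and makes
    \<open>generator F\<close> integrable; it is available on \<open>I\<close>, where the law is
    concentrated.\<close>
  have gen: "\<bar>generator F x\<bar> \<le> 2 * B * \<Lambda>" if "x \<in> I" for x
  proof (rule tendsto_upperbound[OF tendsto_rabs[OF generator_rate[where F = F, OF F that]]])
    show "\<forall>\<^sub>F h in at_right 0. \<bar>(measure_pmf.expectation (P h x) F - F x) / h\<bar> \<le> 2 * B * \<Lambda>"
      using eventually_at_right_less[of 0]
      by eventually_elim (use expectation_increment_le[where F = F, OF F that] in \<open>auto simp: divide_le_eq\<close>)
  qed simp
  have int: "integrable ?\<mu> F" "integrable ?\<mu> (indicator A :: 'x \<Rightarrow> real)"
    by (auto intro: integrable_pmf_bounded[where F = F, OF F] integrable_pmf_bounded[of _ 1])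
  have "measure_pmf.expectation ?\<mu> (generator F)
    \<le> measure_pmf.expectation ?\<mu> (\<lambda>x. - c * F x + \<delta> + C * indicator A x)"
  proof (rule integral_mono_AE)
    show "integrable ?\<mu> (generator F)"
      by (rule measure_pmf.integrable_const_bound[where B = "2 * B * \<Lambda>"])
        (auto simp: AE_measure_pmf_iff intro!: gen dest!: law_in_states[OF \<nu> t, rotated] simp del: set_bind_pmf)
    show "AE x in ?\<mu>. generator F x \<le> - c * F x + \<delta> + C * indicator A x"
      using drift law_in_states[OF \<nu> t] by (auto simp: AE_measure_pmf_iff)
  qed (use int in auto)
  also have "\<dots> = - c * measure_pmf.expectation ?\<mu> F + \<delta> + C * measure_pmf.prob ?\<mu> A"
    using int by simp
  finally show "measure_pmf.expectation ?\<mu> (generator F)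
    \<le> - c * measure_pmf.expectation ?\<mu> F + \<delta> + C * measure_pmf.prob ?\<mu> A" .
qed

end

section \<open>The generator of the occupancy process\<close>

text \<open>For the second claim, complete \<open>v\<close> to one admissible sample. It is drawn
  with probability at least \<open>1 / 2 ^ card N\<close>, as samples are subsets of
  \<open>N\<close>; \<open>v\<close> is then among its least loaded servers, at most
  \<open>card N\<close> in number, and wins the tie with probability at least
  \<open>1 / card N\<close>. The crude bound is uniform in \<open>d\<close> and
  \<open>x\<close>.\<close>

lemma
  assumes N: "finite N" "N \<noteq> {}" and d: "d \<ge> 1"
  shows set_pmf_power_of_d: "set_pmf (power_of_d d N x) \<subseteq> N"
    and pmf_power_of_d_least: "\<lbrakk>v \<in> N; \<And>w. w \<in> N \<Longrightarrow> x v \<le> x w\<rbrakk> \<Longrightarrow>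
      1 / (real (card N) * 2 ^ card N) \<le> pmf (power_of_d d N x) v"
proof -
  define c where "c = min d (card N)"
  have c: "1 \<le> c" "c \<le> card N" using N d by (auto simp: c_def Suc_le_eq card_gt_0_iff)
  define \<A> where "\<A> = {A. A \<subseteq> N \<and> card A = c}"
  define least where "least A = {v \<in> A. \<forall>w \<in> A. x v \<le> x w}" for A
  have fin: "finite \<A>" using N by (auto simp: \<A>_def)
  have finA: "finite A" "A \<noteq> {}" "A \<subseteq> N" if "A \<in> \<A>" for A
    using that c N by (auto simp: \<A>_def intro: finite_subset)
  have least: "finite (least A)" "least A \<noteq> {}" "least A \<subseteq> N" if "A \<in> \<A>" for A
  proof -
    have "arg_min_on x A \<in> A" "\<forall>w\<in>A. x (arg_min_on x A) \<le> x w"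
      using finA[OF that] by (auto intro: arg_min_if_finite(1) arg_min_least)
    then show "least A \<noteq> {}" by (auto simp: least_def)
  qed (use finA[OF that] in \<open>auto simp: least_def\<close>)
  have "\<A> \<noteq> {}"
    using obtain_subset_with_card_n[OF c(2)] by (auto simp: \<A>_def)
  have eq: "power_of_d d N x = bind_pmf (pmf_of_set \<A>) (\<lambda>A. pmf_of_set (least A))"
    by (simp add: power_of_d_def \<A>_def least_def c_def)
  show "set_pmf (power_of_d d N x) \<subseteq> N"
    unfolding eq using fin \<open>\<A> \<noteq> {}\<close> least by (auto simp: UN_subset_iff)
  assume v: "v \<in> N" "\<And>w. w \<in> N \<Longrightarrow> x v \<le> x w"
  have "c - 1 \<le> card (N - {v})" using c v N by simp
  then obtain A' where A': "A' \<subseteq> N - {v}" "card A' = c - 1" "finite A'"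
    by (rule obtain_subset_with_card_n)
  define A where "A = insert v A'"
  have A: "A \<in> \<A>"
    using A' v c by (auto simp: A_def \<A>_def card_insert_if)
  have "v \<in> least A" using v finA[OF A] by (auto simp: least_def A_def)
  have "card \<A> \<le> card (Pow N)" using N by (intro card_mono) (auto simp: \<A>_def)
  then have "real (card \<A>) \<le> real (2 ^ card N)"
    using N by (simp only: card_Pow of_nat_le_iff)
  then have card\<A>: "real (card \<A>) \<le> 2 ^ card N" by simp
  have card\<A>0: "card \<A> > 0" using fin \<open>\<A> \<noteq> {}\<close> by (simp add: card_gt_0_iff)
  have "1 / real (card N) \<le> 1 / real (card (least A))"
    using least[OF A] N by (intro divide_left_mono) (auto simp: card_mono card_gt_0_iff)
  also have "\<dots> = pmf (pmf_of_set (least A)) v"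
    using least[OF A] \<open>v \<in> least A\<close> by simp
  also have "\<dots> \<le> (\<Sum>A\<in>\<A>. pmf (pmf_of_set (least A)) v)"
    using A fin by (intro member_le_sum) auto
  finally have "1 / real (card N) / 2 ^ card N \<le> (\<Sum>A\<in>\<A>. pmf (pmf_of_set (least A)) v) / real (card \<A>)"
    using card\<A> card\<A>0 by (intro frac_le) (auto intro: sum_nonneg)
  also have "\<dots> = pmf (power_of_d d N x) v"
    unfolding eq pmf_bind using fin \<open>\<A> \<noteq> {}\<close> by (subst integral_pmf_of_set) auto
  finally show "1 / (real (card N) * 2 ^ card N) \<le> pmf (power_of_d d N x) v" by simp
qed

locale power_of_d_network =
  fixes d :: nat and D :: "'d set" and S :: "'s set" and E :: "('d \<times> 's) set"
    and lam :: "'d \<Rightarrow> real" and mu :: "'s \<Rightarrow> real"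
    and P :: "real \<Rightarrow> ('s \<Rightarrow> nat) \<Rightarrow> ('s \<Rightarrow> nat) pmf"
  assumes d: "d \<ge> 1"
    and network: "network D S E"
    and lam_pos: "e \<in> D \<Longrightarrow> lam e > 0"
    and mu_pos: "v \<in> S \<Longrightarrow> mu v > 0"
    and transition: "transition_function (S \<rightarrow>\<^sub>E UNIV) P"
    and rates: "has_transition_rates (S \<rightarrow>\<^sub>E UNIV) P (occupancy_rate d D S E lam mu)"
begin

abbreviation N where "N \<equiv> servers_of E"

abbreviation arrive :: "('s \<Rightarrow> nat) \<Rightarrow> 's \<Rightarrow> 's \<Rightarrow> nat" where "arrive x v \<equiv> x(v := x v + 1)"

abbreviation depart :: "('s \<Rightarrow> nat) \<Rightarrow> 's \<Rightarrow> 's \<Rightarrow> nat" where "depart x v \<equiv> x(v := x v - 1)"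

abbreviation busy :: "('s \<Rightarrow> nat) \<Rightarrow> 's set" where "busy x \<equiv> {v \<in> S. x v > 0}"

text \<open>A finite superset of the reachable states suffices: arrivals at a server without any
  compatible dispatcher are included and have rate 0.\<close>

definition succs :: "('s \<Rightarrow> nat) \<Rightarrow> ('s \<Rightarrow> nat) set" where
  "succs x = arrive x ` S \<union> depart x ` busy x"

lemma finite_D [simp]: "finite D" and finite_S [simp]: "finite S"
  using network by (auto simp: network_def)

lemma N_subset: "N e \<subseteq> S"
  using network by (auto simp: network_def servers_of_def)

lemma finite_N [simp]: "finite (N e)"
  using N_subset finite_S by (rule finite_subset)

lemma finite_succs [simp]: "finite (succs x)"
  by (simp add: succs_def)

text \<open>Passes from target states to events, each keeping its own weight. With
  \<open>g = 1\<close> this gives the exit rate, with the increment of a function the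
  generator.\<close>

lemma sum_rates:
  "(\<Sum>y\<in>succs x. occupancy_rate d D S E lam mu x y * g y) =
    (\<Sum>e\<in>{e \<in> D. N e \<noteq> {}}. lam e * (\<Sum>v\<in>N e. pmf (power_of_d d (N e) x) v * g (arrive x v))) +
    (\<Sum>v\<in>busy x. mu v * g (depart x v))"
proof -
  have arr: "(\<Sum>y\<in>succs x. pmf (map_pmf (arrive x) (power_of_d d (N e) x)) y * g y)
    = (\<Sum>v\<in>N e. pmf (power_of_d d (N e) x) v * g (arrive x v))" if "N e \<noteq> {}" for e
  proof -
    have sub: "set_pmf (power_of_d d (N e) x) \<subseteq> N e"
      by (rule set_pmf_power_of_d[OF finite_N that d])
    have "(\<Sum>y\<in>succs x. pmf (map_pmf (arrive x) (power_of_d d (N e) x)) y * g y)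
      = measure_pmf.expectation (map_pmf (arrive x) (power_of_d d (N e) x)) g"
      using sub N_subset by (subst integral_measure_pmf[of "succs x"]) (auto simp: succs_def)
    also have "\<dots> = measure_pmf.expectation (power_of_d d (N e) x) (\<lambda>v. g (arrive x v))"
      by simp
    also have "\<dots> = (\<Sum>v\<in>N e. pmf (power_of_d d (N e) x) v * g (arrive x v))"
      using sub by (subst integral_measure_pmf[of "N e"]) auto
    finally show ?thesis .
  qed
  have dep: "(\<Sum>y\<in>succs x. (if y = depart x v then mu v else 0) * g y) = mu v * g (depart x v)"
    if "v \<in> busy x" for v
  proof -
    have "(\<Sum>y\<in>succs x. (if y = depart x v then mu v else 0) * g y)
      = (\<Sum>y\<in>succs x. if y = depart x v then mu v * g (depart x v) else 0)"
      by (intro sum.cong) auto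
    also have "\<dots> = mu v * g (depart x v)"
      using that by (subst sum.delta) (auto simp: succs_def)
    finally show ?thesis .
  qed
  have "(\<Sum>y\<in>succs x. occupancy_rate d D S E lam mu x y * g y) =
    (\<Sum>y\<in>succs x. \<Sum>e\<in>{e \<in> D. N e \<noteq> {}}.
        lam e * (pmf (map_pmf (arrive x) (power_of_d d (N e) x)) y * g y)) +
    (\<Sum>y\<in>succs x. \<Sum>v\<in>busy x. (if y = depart x v then mu v else 0) * g y)"
    by (simp add: occupancy_rate_def distrib_right sum.distrib sum_distrib_right mult.assoc)
  also have "\<dots> = (\<Sum>e\<in>{e \<in> D. N e \<noteq> {}}.
      lam e * (\<Sum>y\<in>succs x. pmf (map_pmf (arrive x) (power_of_d d (N e) x)) y * g y)) +
    (\<Sum>v\<in>busy x. \<Sum>y\<in>succs x. (if y = depart x v then mu v else 0) * g y)"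
    by (subst (1 2) sum.swap) (simp only: sum_distrib_left)
  also have "\<dots> = (\<Sum>e\<in>{e \<in> D. N e \<noteq> {}}.
      lam e * (\<Sum>v\<in>N e. pmf (power_of_d d (N e) x) v * g (arrive x v))) +
    (\<Sum>v\<in>busy x. mu v * g (depart x v))"
    using arr dep by (intro arg_cong2[where f = "(+)"] sum.cong) auto
  finally show ?thesis .
qed

sublocale bounded_rates_chain "S \<rightarrow>\<^sub>E UNIV" P "occupancy_rate d D S E lam mu" succs
  "sum lam D + sum mu S"
proof
  fix x :: "'s \<Rightarrow> nat" assume x: "x \<in> S \<rightarrow>\<^sub>E UNIV"
  have upd: "x(v := k) \<in> (S \<rightarrow>\<^sub>E UNIV) - {x}" if "v \<in> S" "k \<noteq> x v" for v k
    using x that by (auto simp: PiE_iff extensional_def dest: fun_cong[of _ _ v])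
  show "succs x \<subseteq> (S \<rightarrow>\<^sub>E UNIV) - {x}"
    unfolding succs_def by (intro Un_least image_subsetI; rule upd) auto
  show "occupancy_rate d D S E lam mu x y = 0" if "y \<in> (S \<rightarrow>\<^sub>E UNIV) - {x} - succs x" for y
  proof -
    have "pmf (map_pmf (arrive x) (power_of_d d (N e) x)) y = 0" if "N e \<noteq> {}" for e
      using set_pmf_power_of_d[OF finite_N that d, of x] N_subset[of e] \<open>y \<in> _\<close>
      by (auto simp: pmf_eq_0_set_pmf succs_def)
    then show ?thesis
      using that by (auto simp: occupancy_rate_def succs_def intro!: sum.neutral)
  qed
  have "(\<Sum>y\<in>succs x. occupancy_rate d D S E lam mu x y)
    = (\<Sum>e\<in>{e \<in> D. N e \<noteq> {}}. lam e * (\<Sum>v\<in>N e. pmf (power_of_d d (N e) x) v)) + sum mu (busy x)"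
    using sum_rates[of x "\<lambda>_. 1"] by simp
  also have "\<dots> = sum lam {e \<in> D. N e \<noteq> {}} + sum mu (busy x)"
    using set_pmf_power_of_d[OF finite_N _ d] by (simp add: sum_pmf_eq_1)
  also have "\<dots> \<le> sum lam D + sum mu S"
    using lam_pos mu_pos by (intro add_mono sum_mono2) (auto simp: less_imp_le)
  finally show "(\<Sum>y\<in>succs x. occupancy_rate d D S E lam mu x y) \<le> sum lam D + sum mu S" .
qed (auto simp: transition rates)

lemma generator_eq:
  "generator F x =
    (\<Sum>e\<in>{e \<in> D. N e \<noteq> {}}. lam e * (\<Sum>v\<in>N e. pmf (power_of_d d (N e) x) v * (F (arrive x v) - F x))) +
    (\<Sum>v\<in>busy x. mu v * (F (depart x v) - F x))"
  unfolding generator_def by (rule sum_rates)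

text \<open>For a function that decreases with every arrival, all arrivals can be dropped from the drift
  except those that selected dispatchers send to a least loaded server.\<close>

lemma generator_le:
  assumes mono: "\<And>v. F (arrive x v) \<le> F x"
    and A: "A \<subseteq> D" and r: "r \<ge> 0"
    and least: "\<And>e w. e \<in> A \<Longrightarrow> w \<in> N e \<Longrightarrow> x (least e) \<le> x w"
    and least_mem: "\<And>e. e \<in> A \<Longrightarrow> least e \<in> N e"
    and r_le: "\<And>e. e \<in> A \<Longrightarrow> r \<le> lam e / (real (card (N e)) * 2 ^ card (N e))"
  shows "generator F x \<le> (\<Sum>e\<in>A. r * (F (arrive x (least e)) - F x)) +
    (\<Sum>v\<in>busy x. mu v * (F (depart x v) - F x))"
proof -
  let ?g = "\<lambda>e. lam e * (\<Sum>v\<in>N e. pmf (power_of_d d (N e) x) v * (F (arrive x v) - F x))"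
  have nonpos: "pmf p v * (F (arrive x v) - F x) \<le> 0" for p and v :: 's
    using mono by (intro mult_nonneg_nonpos) auto
  have "?g e \<le> 0" if "e \<in> D" for e
    using lam_pos[OF that] by (intro mult_nonneg_nonpos sum_nonpos nonpos) auto
  then have "sum ?g {e \<in> D. N e \<noteq> {}} \<le> sum ?g A"
    using A least_mem sum_mono2[of "{e \<in> D. N e \<noteq> {}}" A "\<lambda>e. - ?g e"]
    by (fastforce simp: sum_negf)
  also have "\<dots> \<le> (\<Sum>e\<in>A. r * (F (arrive x (least e)) - F x))"
  proof (rule sum_mono)
    fix e assume e: "e \<in> A"
    let ?p = "pmf (power_of_d d (N e) x) (least e)"
    have "e \<in> D" "N e \<noteq> {}" using A least_mem e by auto
    have "(\<Sum>v\<in>N e. pmf (power_of_d d (N e) x) v * (F (arrive x v) - F x))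
      \<le> (\<Sum>v\<in>{least e}. pmf (power_of_d d (N e) x) v * (F (arrive x v) - F x))"
      using least_mem[OF e] nonpos
        sum_mono2[of "N e" "{least e}" "\<lambda>v. - (pmf (power_of_d d (N e) x) v * (F (arrive x v) - F x))"]
      by (auto simp: sum_negf)
    then have "?g e \<le> lam e * (?p * (F (arrive x (least e)) - F x))"
      using lam_pos[OF \<open>e \<in> D\<close>] by (intro mult_left_mono) auto
    also have "\<dots> = (lam e * ?p) * (F (arrive x (least e)) - F x)" by simp
    \<comment> \<open>The increment is nonpositive, so a lower bound on the rate becomes an upper
      bound on the drift.\<close>
    also have "\<dots> \<le> r * (F (arrive x (least e)) - F x)"
    proof (rule mult_right_mono_neg)
      have "r \<le> lam e * (1 / (real (card (N e)) * 2 ^ card (N e)))" using r_le[OF e] by simp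
      also have "\<dots> \<le> lam e * ?p"
        using lam_pos[OF \<open>e \<in> D\<close>] least least_mem e
        by (intro mult_left_mono pmf_power_of_d_least[OF finite_N \<open>N e \<noteq> {}\<close> d]) auto
      finally show "r \<le> lam e * ?p" .
    qed (use mono in auto)
    finally show "?g e \<le> r * (F (arrive x (least e)) - F x)" .
  qed
  finally show ?thesis unfolding generator_eq by simp
qed

end

section \<open>Drift estimates for a sunflower of dispatchers\<close>

text \<open>Quantitative bounds are imposed only on the dispatchers in \<open>B\<close> and their
  servers; the rest of the network may have arbitrary positive rates.\<close>

locale sunflower_network = power_of_d_network d D S E lam mu P
  for d :: nat and D :: "'d set" and S :: "'s set" and E :: "('d \<times> 's) set"
    and lam :: "'d \<Rightarrow> real" and mu :: "'s \<Rightarrow> real"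
    and P :: "real \<Rightarrow> ('s \<Rightarrow> nat) \<Rightarrow> ('s \<Rightarrow> nat) pmf" +
  fixes a :: nat and lmin mmax :: real and B :: "'d set" and K :: "'s set"
    and \<nu> :: "('s \<Rightarrow> nat) pmf"
  assumes lmin: "lmin > 0" and mmax: "mmax > 0"
    and B: "B \<subseteq> D" "B \<noteq> {}"
    and K: "K \<noteq> {}" "e \<in> B \<Longrightarrow> K \<subseteq> servers_of E e"
    and card_N: "e \<in> B \<Longrightarrow> card (servers_of E e) \<le> a"
    and lam_ge: "e \<in> B \<Longrightarrow> lam e \<ge> lmin"
    and mu_le: "e \<in> B \<Longrightarrow> v \<in> servers_of E e \<Longrightarrow> mu v \<le> mmax"
    and disjoint_petals: "e \<in> B \<Longrightarrow> e' \<in> B \<Longrightarrow> e \<noteq> e' \<Longrightarrow> servers_of E e \<inter> servers_of E e' \<subseteq> K"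
    and initial: "set_pmf \<nu> \<subseteq> S \<rightarrow>\<^sub>E UNIV"
begin

definition m :: real where "m = real (card B)"
text \<open>A lower bound for the rate at which a dispatcher in \<open>B\<close> feeds any given
  least loaded server of its own.\<close>

definition r :: real where "r = lmin / (real a * 2 ^ a)"
text \<open>An upper bound for the total service rate of one petal, and also of the core, each
  having at most \<open>a\<close> servers.\<close>

definition b :: real where "b = real a * mmax"
text \<open>If at least \<open>\<beta> m\<close> petals have deficit at most \<open>j + 1\<close>, then arrivals dominate departures as long
  as fewer than \<open>2 \<kappa> \<beta> m\<close> petals have deficit at most \<open>j\<close>.\<close>

definition \<kappa> :: real where "\<kappa> = r / (4 * (r + b))"

definition petal :: "'d \<Rightarrow> 's set" where "petal e = N e - K"

text \<open>Truncated subtraction: servers above level \<open>l\<close> do not contribute.\<close>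

definition deficit :: "'s set \<Rightarrow> nat \<Rightarrow> ('s \<Rightarrow> nat) \<Rightarrow> nat" where
  "deficit A l x = (\<Sum>v\<in>A. l - x v)"

definition near :: "nat \<Rightarrow> nat \<Rightarrow> ('s \<Rightarrow> nat) \<Rightarrow> 'd set" where
  "near l j x = {e \<in> B. deficit (petal e) l x \<le> j}"

definition low_core :: "nat \<Rightarrow> ('s \<Rightarrow> nat) set" where
  "low_core l = {x. \<exists>v\<in>K. x v < l}"

text \<open>The core must be included: a core server below level \<open>l\<close> could absorb the
  tasks meant for the petals.\<close>

definition bad :: "nat \<Rightarrow> nat \<Rightarrow> real \<Rightarrow> ('s \<Rightarrow> nat) set" where
  "bad l j \<beta> = low_core l \<union> {x. real (card (near l j x)) < \<beta> * m}"

abbreviation prob_at :: "('s \<Rightarrow> nat) set \<Rightarrow> real \<Rightarrow> real" where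
  "prob_at A t \<equiv> measure_pmf.prob (bind_pmf \<nu> (P t)) A"

lemma finite_B [simp]: "finite B"
  using B(1) finite_D by (rule finite_subset)

lemma m_pos: "m > 0"
  using B by (simp add: m_def card_gt_0_iff)

lemma K_subset: "K \<subseteq> S"
  using B K N_subset by blast

lemma finite_K [simp]: "finite K"
  using K_subset finite_S by (rule finite_subset)

lemma finite_petal [simp]: "finite (petal e)"
  by (simp add: petal_def)

lemma finite_near [simp]: "finite (near l j x)"
  by (simp add: near_def)

lemma card_near_le: "real (card (near l j x)) \<le> m"
  by (auto simp: near_def m_def intro!: card_mono)

lemma card_K: "0 < card K" "card K \<le> a"
proof -
  show "0 < card K" using K by (simp add: card_gt_0_iff)
  obtain e where "e \<in> B" using B by auto
  then have "card K \<le> card (N e)" using K by (intro card_mono) auto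
  then show "card K \<le> a" using card_N[OF \<open>e \<in> B\<close>] by simp
qed

lemma a_pos: "a > 0"
  using card_K by simp

lemma mu_K_le: "v \<in> K \<Longrightarrow> mu v \<le> mmax"
  using B K mu_le by blast

lemma r_pos: "r > 0" and b_pos: "b > 0"
  using a_pos lmin mmax by (auto simp: r_def b_def)

lemma \<kappa>_pos: "\<kappa> > 0" and \<kappa>_less_1: "\<kappa> < 1"
  using r_pos b_pos by (auto simp: \<kappa>_def field_simps)

lemma r_le:
  assumes "e \<in> B"
  shows "r \<le> lam e / (real (card (N e)) * 2 ^ card (N e))"
proof -
  have "0 < card (N e)" using K assms by (auto simp: card_gt_0_iff)
  then show ?thesis
    unfolding r_def using lam_ge[OF assms] card_N[OF assms] lmin
    by (intro frac_le mult_mono power_increasing) auto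
qed

definition least_server :: "('s \<Rightarrow> nat) \<Rightarrow> 'd \<Rightarrow> 's" where
  "least_server x e = arg_min_on x (N e)"

lemma least_server:
  assumes "e \<in> B"
  shows "least_server x e \<in> N e" "w \<in> N e \<Longrightarrow> x (least_server x e) \<le> x w"
proof -
  have "N e \<noteq> {}" using K assms by auto
  then show "least_server x e \<in> N e" "w \<in> N e \<Longrightarrow> x (least_server x e) \<le> x w"
    by (auto simp: least_server_def intro: arg_min_if_finite(1) arg_min_least)
qed

section \<open>Effect of one arrival or departure on deficits\<close>

lemma deficit_arrive_le: "deficit A l (arrive x v) \<le> deficit A l x"
  unfolding deficit_def by (intro sum_mono) auto

lemma deficit_arrive:
  assumes "finite A" "v \<in> A" "x v < l"
  shows "deficit A l (arrive x v) + 1 = deficit A l x"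
proof -
  have "(\<Sum>w\<in>A - {v}. l - arrive x v w) = (\<Sum>w\<in>A - {v}. l - x w)"
    by (intro sum.cong) auto
  then show ?thesis using assms by (simp add: deficit_def sum.remove[of A v])
qed

lemma deficit_cong: "(\<And>w. w \<in> A \<Longrightarrow> x w = y w) \<Longrightarrow> deficit A l x = deficit A l y"
  by (simp add: deficit_def)

lemma deficit_depart_le: 
  assumes "finite A"
  shows "deficit A l (depart x v) \<le> deficit A l x + 1"
proof (cases "v \<in> A")
  case True
  have "(\<Sum>w\<in>A - {v}. l - depart x v w) = (\<Sum>w\<in>A - {v}. l - x w)"
    by (intro sum.cong) auto
  then show ?thesis using assms True by (simp add: deficit_def sum.remove[of A v])
next
  case False
  then have "deficit A l (depart x v) = deficit A l x" by (intro deficit_cong) auto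
  then show ?thesis by simp
qed

lemma deficit_le: "deficit A l x \<le> card A * l"
  unfolding deficit_def by (rule order_trans[OF sum_mono[of _ _ "\<lambda>_. l"]]) auto

lemma near_arrive: "near l j x \<subseteq> near l j (arrive x v)"
  using order_trans[OF deficit_arrive_le] unfolding near_def by blast

text \<open>Here disjointness of the petals matters: \<open>v\<close> lies in the petal of
  \<open>e\<close> and of no other dispatcher in \<open>B\<close>, so one departure lowers the count
  by at most one.\<close>

lemma near_depart:
  assumes "e \<in> B" "v \<in> petal e"
  shows "near l j x - {e} \<subseteq> near l j (depart x v)"
proof
  fix e' assume e': "e' \<in> near l j x - {e}"
  then have "v \<notin> petal e'"
    using assms disjoint_petals[of e e'] by (auto simp: petal_def near_def)
  then have "deficit (petal e') l (depart x v) = deficit (petal e') l x"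
    by (intro deficit_cong) auto
  then show "e' \<in> near l j (depart x v)" using e' by (auto simp: near_def)
qed

lemma near_depart_outside:
  assumes "\<And>e. e \<in> near l j x \<Longrightarrow> v \<notin> petal e"
  shows "near l j x \<subseteq> near l j (depart x v)"
proof
  fix e assume e: "e \<in> near l j x"
  have "deficit (petal e) l (depart x v) = deficit (petal e) l x"
    using assms[OF e] by (intro deficit_cong) auto
  then show "e \<in> near l j (depart x v)" using e by (auto simp: near_def)
qed

end

section \<open>Scalar inequalities for the truncated quadratic penalty\<close>

lemma card_UN_le_mult:
  assumes "finite I" "\<And>i. i \<in> I \<Longrightarrow> card (A i) \<le> n"
  shows "card (\<Union>i\<in>I. A i) \<le> card I * n"
  using card_UN_le[OF assms(1), of A] sum_bounded_above[of I "\<lambda>i. card (A i)" n] assms(2) by fastforce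

text \<open>\<open>N\<close> and \<open>N1\<close> count the petals with deficit at most
  \<open>j\<close> and \<open>j + 1\<close>. The choice of \<open>h\<close> makes
  \<open>r * h * N1\<close> at least \<open>2 * (r + b)\<close>, while \<open>z > 0\<close> forces
  \<open>N * h \<le> 1\<close>; the part linear in \<open>h\<close> is then at most
  \<open>- 2 * (r + b) * z\<close>. The quadratic part is \<open>h\<^sup>2\<close> times a total
  rate of at most \<open>(r + b) * m\<close>, hence of order 1/m.\<close>

lemma drift_bound_good:
  fixes r b m h N N1 \<beta> z :: real
  assumes "r > 0" "b > 0" "m > 0" "\<beta> > 0" "0 \<le> N" "N \<le> N1" "N1 \<le> m" "\<beta> * m \<le> N1"
    and h: "h = 1 / (2 * (r / (4 * (r + b)) * \<beta>) * m)"
    and z: "z = max 0 (1 - N * h)"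
  shows "(N1 - N) * (r * (h\<^sup>2 - 2 * z * h)) + N * (b * (2 * z * h + h\<^sup>2))
    \<le> - (2 * (r + b)) * z\<^sup>2 + (r + b) * m * h\<^sup>2"
proof -
  have h': "h = 2 * (r + b) / (r * \<beta> * m)" using assms(1-4) by (simp add: h field_simps)
  have h0: "h > 0" using assms(1-4) by (simp add: h')
  have quad: "(N1 - N) * r + N * b \<le> (r + b) * m"
  proof -
    have "(N1 - N) * r \<le> m * r" "N * b \<le> m * b" using assms by (auto intro!: mult_right_mono)
    then show ?thesis by (simp add: algebra_simps)
  qed
  have lin: "2 * z * (h * (N * b - (N1 - N) * r)) \<le> - (2 * (r + b)) * z\<^sup>2"
  proof (cases "z = 0")
    case False
    then have z': "z = 1 - N * h" "0 < z" by (auto simp: z max_def split: if_splits)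
    then have "z \<le> 1" "N * h \<le> 1" using h0 assms by auto
    have "h * (N * b - (N1 - N) * r) = (r + b) * (N * h) - r * (h * N1)" by (simp add: algebra_simps)
    also have "\<dots> \<le> (r + b) * 1 - r * (h * (\<beta> * m))"
      using assms h0 \<open>N * h \<le> 1\<close> by (intro diff_mono mult_left_mono) auto
    also have "r * (h * (\<beta> * m)) = 2 * (r + b)" using assms(1-4) by (simp add: h')
    finally have "h * (N * b - (N1 - N) * r) \<le> - (r + b)" by simp
    then have "2 * z * (h * (N * b - (N1 - N) * r)) \<le> 2 * z * (- (r + b))"
      using z' by (intro mult_left_mono) auto
    \<comment> \<open>As \<open>z \<le> 1\<close>, a drift linear in \<open>z\<close> is stronger
      than one proportional to the penalty \<open>z * z\<close>.\<close>
    also have "\<dots> \<le> 2 * (z * z) * (- (r + b))"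
      using z' \<open>z \<le> 1\<close> assms by (intro mult_right_mono_neg mult_left_mono) (auto intro: mult_left_le)
    finally show ?thesis by (simp add: power2_eq_square algebra_simps)
  qed simp
  have "(N1 - N) * (r * (h\<^sup>2 - 2 * z * h)) + N * (b * (2 * z * h + h\<^sup>2))
    = 2 * z * (h * (N * b - (N1 - N) * r)) + ((N1 - N) * r + N * b) * h\<^sup>2"
    by (simp add: algebra_simps)
  also have "\<dots> \<le> - (2 * (r + b)) * z\<^sup>2 + (r + b) * m * h\<^sup>2"
    using lin quad by (intro add_mono mult_right_mono) auto
  finally show ?thesis .
qed

text \<open>No arrivals are counted. Since \<open>z * N * h \<le> 1\<close>, departures contribute
  at most \<open>2 * b\<close> at first order, and supplying the missing decay term costs at most
  \<open>2 * (r + b)\<close>; together this stays below \<open>4 * (r + b)\<close>.\<close>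

lemma drift_bound_bad:
  fixes r b m h N z :: real
  assumes "r > 0" "b > 0" "h > 0" "0 \<le> N" "N \<le> m"
    and z: "z = max 0 (1 - N * h)"
  shows "N * (b * (2 * z * h + h\<^sup>2))
    \<le> - (2 * (r + b)) * z\<^sup>2 + (r + b) * m * h\<^sup>2 + 4 * (r + b)"
proof -
  have zNh: "z \<ge> 0" "z \<le> 1" using assms by (auto simp: z)
  have "z * (N * h) \<le> 1"
  proof (cases "z = 0")
    case False
    then have "N * h \<le> 1" using assms by (auto simp: z max_def split: if_splits)
    then have "z * (N * h) \<le> 1 * 1" using zNh assms by (intro mult_mono) auto
    then show ?thesis by simp
  qed simp
  then have 1: "2 * b * (z * (N * h)) \<le> 2 * b" using assms by (simp add: mult_left_le)
  have "z\<^sup>2 \<le> 1" using zNh by (simp add: power_le_one)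
  then have 2: "2 * (r + b) * z\<^sup>2 \<le> 2 * (r + b)" using assms by (intro mult_left_le) auto
  have 3: "N * b * h\<^sup>2 \<le> (r + b) * m * h\<^sup>2"
  proof (rule mult_right_mono)
    have "N * b \<le> m * b" using assms by (intro mult_right_mono) auto
    also have "\<dots> \<le> (r + b) * m" using assms by (simp add: algebra_simps)
    finally show "N * b \<le> (r + b) * m" .
  qed simp
  have "N * (b * (2 * z * h + h\<^sup>2)) = 2 * b * (z * (N * h)) + N * b * h\<^sup>2"
    by (simp add: algebra_simps)
  moreover have "2 * b \<le> 2 * (r + b)" using assms by simp
  ultimately show ?thesis using 1 2 3 by (simp only: mult_minus_left)
qed

text \<open>Leaving the right-hand side untruncated makes its expansion in \<open>h\<close> exact;
  when the truncation becomes active, the left-hand side is 0.\<close>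

lemma truncated_square_decrease:
  fixes N h :: real
  assumes "h > 0"
  shows "(max 0 (1 - (N + 1) * h))\<^sup>2 \<le> (max 0 (1 - N * h) - h)\<^sup>2"
proof (cases "1 - (N + 1) * h > 0")
  case True
  then have "1 - N * h > 0" using assms by (simp add: algebra_simps)
  with True show ?thesis by (simp add: max_def algebra_simps)
next
  case False
  then have "max 0 (1 - (N + 1) * h) = 0" by simp
  then show ?thesis by (simp only:) simp
qed

section \<open>Drift of the petal penalty and of the core deficit\<close>

context sunflower_network
begin

text \<open>The square makes the penalty flat where it vanishes, so that departures cost only \<open>O(h)\<close>
  there; here \<open>h\<close> is of order \<open>1 / m\<close>.\<close>

definition near_penalty :: "real \<Rightarrow> nat \<Rightarrow> nat \<Rightarrow> ('s \<Rightarrow> nat) \<Rightarrow> real" where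
  "near_penalty h l j x = (max 0 (1 - real (card (near l j x)) * h))\<^sup>2"

lemma near_penalty_bounds:
  assumes "h \<ge> 0"
  shows "0 \<le> near_penalty h l j x" "near_penalty h l j x \<le> 1"
  using assms by (auto simp: near_penalty_def power_le_one)

lemma near_penalty_antimono:
  assumes "h \<ge> 0" "card (near l j x) \<le> card (near l j y)"
  shows "near_penalty h l j y \<le> near_penalty h l j x"
  unfolding near_penalty_def using assms
  by (intro power_mono max.mono diff_left_mono mult_right_mono) auto

text \<open>Only departures from petals that are already near can raise the penalty. Their total
  rate is at most \<open>b\<close> per near petal, and each moves the root \<open>z\<close> up by at
  most \<open>h\<close>.\<close>

lemma near_penalty_depart:
  assumes h: "h > 0" and x: "z = max 0 (1 - real (card (near l j x)) * h)"
  shows "(\<Sum>v\<in>busy x. mu v * (near_penalty h l j (depart x v) - near_penalty h l j x))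
    \<le> real (card (near l j x)) * (b * (2 * z * h + h\<^sup>2))"
proof -
  let ?F = "near_penalty h l j"
  let ?U = "\<Union>e\<in>near l j x. petal e"
  have z: "z \<ge> 0" by (simp add: x)
  have pos: "0 \<le> 2 * z * h + h\<^sup>2" using z h by simp
  have U: "finite ?U" "?U \<subseteq> S" using N_subset by (auto simp: petal_def)
  have step: "?F (depart x v) - ?F x \<le> (if v \<in> ?U then 2 * z * h + h\<^sup>2 else 0)" for v
  proof (cases "v \<in> ?U")
    case True
    then obtain e where e: "e \<in> near l j x" "v \<in> petal e" by auto
    then have "card (near l j x - {e}) \<le> card (near l j (depart x v))"
      by (intro card_mono near_depart) (auto simp: near_def)
    then have "real (card (near l j x)) - 1 \<le> real (card (near l j (depart x v)))"
      using e by simp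
    then have "real (card (near l j x)) * h - h \<le> real (card (near l j (depart x v))) * h"
      using h mult_right_mono[of "real (card (near l j x)) - 1" _ h] by (simp add: left_diff_distrib)
    then have "max 0 (1 - real (card (near l j (depart x v))) * h) \<le> z + h"
      using h by (auto simp: x)
    then have "?F (depart x v) \<le> (z + h)\<^sup>2"
      unfolding near_penalty_def by (intro power_mono) auto
    also have "\<dots> = ?F x + (2 * z * h + h\<^sup>2)"
      by (simp add: near_penalty_def x[symmetric] power2_sum)
    finally show ?thesis using True by simp
  next
    case False
    then have "card (near l j x) \<le> card (near l j (depart x v))"
      by (intro card_mono near_depart_outside) auto
    then show ?thesis using near_penalty_antimono[of h l j x "depart x v"] h False by auto
  qed
  have "(\<Sum>v\<in>busy x. mu v * (?F (depart x v) - ?F x))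
    \<le> (\<Sum>v\<in>busy x. if v \<in> ?U then mmax * (2 * z * h + h\<^sup>2) else 0)"
  proof (rule sum_mono)
    fix v assume v: "v \<in> busy x"
    have "mu v * (?F (depart x v) - ?F x) \<le> mu v * (if v \<in> ?U then 2 * z * h + h\<^sup>2 else 0)"
      using v mu_pos step by (intro mult_left_mono) (auto simp: less_imp_le)
    also have "\<dots> \<le> (if v \<in> ?U then mmax * (2 * z * h + h\<^sup>2) else 0)"
      using pos mu_le by (auto intro!: mult_right_mono simp: petal_def near_def)
    finally show "mu v * (?F (depart x v) - ?F x)
      \<le> (if v \<in> ?U then mmax * (2 * z * h + h\<^sup>2) else 0)" .
  qed
  also have "\<dots> \<le> (\<Sum>v\<in>S. if v \<in> ?U then mmax * (2 * z * h + h\<^sup>2) else 0)"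
    using pos mmax by (intro sum_mono2) auto
  also have "\<dots> = (\<Sum>v\<in>?U. mmax * (2 * z * h + h\<^sup>2))"
    using U by (intro sum.mono_neutral_cong_right) auto
  also have "\<dots> = real (card ?U) * (mmax * (2 * z * h + h\<^sup>2))"
    by (simp only: sum_constant of_nat_id)
  also have "\<dots> \<le> real (card (near l j x) * a) * (mmax * (2 * z * h + h\<^sup>2))"
  proof (intro mult_right_mono of_nat_mono card_UN_le_mult)
    fix e assume "e \<in> near l j x"
    then show "card (petal e) \<le> a"
      using card_N[of e] card_mono[of "N e" "petal e"] by (fastforce simp: petal_def near_def)
  qed (use pos mmax in auto)
  finally show ?thesis by (simp add: b_def mult.assoc)
qed

lemma near_penalty_drift:
  assumes \<beta>: "\<beta> > 0" and h: "h = 1 / (2 * (\<kappa> * \<beta>) * m)"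
  shows "generator (near_penalty h l j) x \<le> - (2 * (r + b)) * near_penalty h l j x
    + (r + b) * m * h\<^sup>2 + 4 * (r + b) * indicator (bad l (Suc j) \<beta>) x"
proof -
  let ?F = "near_penalty h l j"
  define z where "z = max 0 (1 - real (card (near l j x)) * h)"
  have h0: "h > 0" using \<beta> \<kappa>_pos m_pos by (simp add: h)
  have mono: "?F (arrive x v) \<le> ?F x" for v
    using h0 by (intro near_penalty_antimono card_mono near_arrive) auto
  have F: "?F x = z\<^sup>2" by (simp add: near_penalty_def z_def)
  show ?thesis
  proof (cases "x \<in> bad l (Suc j) \<beta>")
    case True
    \<comment> \<open>All arrivals are dropped: in a bad state they may miss the petals, but they
      never raise the penalty.\<close>
    have "generator ?F x \<le> (\<Sum>e\<in>{}. r * (?F (arrive x (least_server x e)) - ?F x)) +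
      (\<Sum>v\<in>busy x. mu v * (?F (depart x v) - ?F x))"
      using r_pos by (intro generator_le mono) auto
    also have "\<dots> \<le> real (card (near l j x)) * (b * (2 * z * h + h\<^sup>2))"
      using near_penalty_depart[OF h0 z_def] by simp
    also have "\<dots> \<le> - (2 * (r + b)) * z\<^sup>2 + (r + b) * m * h\<^sup>2 + 4 * (r + b)"
      by (rule drift_bound_bad[OF r_pos b_pos h0 _ card_near_le z_def]) simp
    finally show ?thesis using True by (simp add: F)
  next
    case False
    \<comment> \<open>The dispatchers with petal deficit exactly \<open>Suc j\<close>. Some petal
      server is below level \<open>l\<close> while the core is not, so the least loaded server lies
      in the petal, and one arrival there makes the petal near.\<close>
    define A where "A = near l (Suc j) x - near l j x"
    have sub: "near l j x \<subseteq> near l (Suc j) x" by (auto simp: near_def)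
    have AB: "A \<subseteq> B" by (auto simp: A_def near_def)
    have cardA: "real (card A) = real (card (near l (Suc j) x)) - real (card (near l j x))"
      using sub card_mono[OF finite_near sub] by (simp add: A_def card_Diff_subset of_nat_diff)
    have gain: "?F (arrive x (least_server x e)) - ?F x \<le> h\<^sup>2 - 2 * z * h" if e: "e \<in> A" for e
    proof -
      let ?v = "least_server x e"
      have eB: "e \<in> B" and def_e: "deficit (petal e) l x = Suc j"
        using e by (auto simp: A_def near_def)
      then have "(\<Sum>v\<in>petal e. l - x v) \<noteq> 0" by (simp add: deficit_def)
      then obtain w where w: "w \<in> petal e" "x w < l" by (auto simp: sum_eq_0_iff)
      then have "x ?v < l" using least_server(2)[OF eB, of w x] by (auto simp: petal_def)
      moreover have "?v \<notin> K" using False \<open>x ?v < l\<close> by (auto simp: bad_def low_core_def)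
      ultimately have "deficit (petal e) l (arrive x ?v) = j"
        using deficit_arrive[of "petal e" ?v x l] def_e least_server(1)[OF eB]
        by (simp add: petal_def)
      then have "insert e (near l j x) \<subseteq> near l j (arrive x ?v)"
        using near_arrive[of l j x ?v] eB by (auto simp: near_def)
      then have "card (insert e (near l j x)) \<le> card (near l j (arrive x ?v))"
        by (intro card_mono) auto
      then have "real (card (near l j x)) + 1 \<le> real (card (near l j (arrive x ?v)))"
        using e by (simp add: A_def)
      then have "?F (arrive x ?v) \<le> (max 0 (1 - (real (card (near l j x)) + 1) * h))\<^sup>2"
        unfolding near_penalty_def using h0
        by (intro power_mono max.mono diff_left_mono mult_right_mono) auto
      also have "\<dots> \<le> (z - h)\<^sup>2" unfolding z_def by (rule truncated_square_decrease[OF h0])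
      also have "\<dots> = ?F x + (h\<^sup>2 - 2 * z * h)" by (simp add: F power2_diff)
      finally show ?thesis by simp
    qed
    have "generator ?F x \<le> (\<Sum>e\<in>A. r * (?F (arrive x (least_server x e)) - ?F x)) +
      (\<Sum>v\<in>busy x. mu v * (?F (depart x v) - ?F x))"
      using AB B r_pos by (intro generator_le mono least_server r_le) auto
    also have "\<dots> \<le> (\<Sum>e\<in>A. r * (h\<^sup>2 - 2 * z * h)) +
      real (card (near l j x)) * (b * (2 * z * h + h\<^sup>2))"
      using gain r_pos by (intro add_mono sum_mono mult_left_mono near_penalty_depart[OF h0 z_def]) auto
    also have "\<dots> = (real (card (near l (Suc j) x)) - real (card (near l j x))) * (r * (h\<^sup>2 - 2 * z * h))
      + real (card (near l j x)) * (b * (2 * z * h + h\<^sup>2))"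
      by (simp add: cardA)
    also have "\<dots> \<le> - (2 * (r + b)) * z\<^sup>2 + (r + b) * m * h\<^sup>2"
      using False card_mono[OF finite_near sub] h
      by (intro drift_bound_good[OF r_pos b_pos m_pos \<beta> _ _ card_near_le _ _ z_def])
        (auto simp: bad_def \<kappa>_def)
    finally show ?thesis using False by (simp add: F)
  qed
qed

text \<open>The drift gives a limiting mean penalty of at most
  \<open>m * h\<^sup>2 / 2 + 2 * q\<close>. If fewer than \<open>\<kappa> * \<beta> * m\<close>
  petals are near, the penalty is at least 1/4, so Markov's inequality multiplies this by 4; a
  further \<open>q\<close> pays for a low core, whence the 9.\<close>

lemma bad_step:
  assumes \<beta>: "\<beta> > 0" and q: "ultimately_le (prob_at (bad l (Suc j) \<beta>)) q"
  shows "ultimately_le (prob_at (bad l j (\<kappa> * \<beta>))) (9 * q + 1 / (2 * (\<kappa> * \<beta>)\<^sup>2 * m))"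
proof -
  define h where "h = 1 / (2 * (\<kappa> * \<beta>) * m)"
  have h0: "h > 0" using \<beta> \<kappa>_pos m_pos by (simp add: h_def)
  let ?F = "near_penalty h l j"
  have F: "\<bar>?F x\<bar> \<le> 1" "0 \<le> ?F x" for x using near_penalty_bounds[of h l j x] h0 by auto
  have rb: "r + b > 0" using r_pos b_pos by simp
  have "ultimately_le (\<lambda>t. measure_pmf.expectation (bind_pmf \<nu> (P t)) ?F)
    (((r + b) * m * h\<^sup>2 + 4 * (r + b) * q) / (2 * (r + b)))"
    using rb by (intro lyapunov_bound[OF F(1) initial _ _ near_penalty_drift[OF \<beta> h_def] q]) auto
  moreover have "((r + b) * m * h\<^sup>2 + 4 * (r + b) * q) / (2 * (r + b)) = m * h\<^sup>2 / 2 + 2 * q"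
    using rb by (simp add: field_simps)
  ultimately have EF: "ultimately_le (\<lambda>t. measure_pmf.expectation (bind_pmf \<nu> (P t)) ?F) (m * h\<^sup>2 / 2 + 2 * q)"
    by (simp only:)
  have few: "prob_at {x. real (card (near l j x)) < \<kappa> * \<beta> * m} t
    \<le> 4 * measure_pmf.expectation (bind_pmf \<nu> (P t)) ?F" for t
  proof -
    have "1/4 \<le> ?F x" if "real (card (near l j x)) < \<kappa> * \<beta> * m" for x
    proof -
      have "real (card (near l j x)) * h \<le> \<kappa> * \<beta> * m * h"
        using that h0 by (intro mult_right_mono) auto
      also have "\<dots> = 1 / 2" using \<beta> \<kappa>_pos m_pos by (simp add: h_def)
      finally have "(1/2)\<^sup>2 \<le> ?F x"
        unfolding near_penalty_def by (intro power_mono) auto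
      then show ?thesis by (simp add: power2_eq_square)
    qed
    then show ?thesis
      using markov_inequality_pmf[of ?F 1 "1/4" "{x. real (card (near l j x)) < \<kappa> * \<beta> * m}" "bind_pmf \<nu> (P t)"] F
      by simp
  qed
  show ?thesis
  proof (rule ultimately_le_mono[OF ultimately_le_add[OF q ultimately_le_cmult[OF EF, of 4]]])
    fix t :: real
    have "prob_at (bad l j (\<kappa> * \<beta>)) t
      \<le> prob_at (low_core l) t + prob_at {x. real (card (near l j x)) < \<kappa> * \<beta> * m} t"
      unfolding bad_def by (rule measure_Un_le) auto
    also have "prob_at (low_core l) t \<le> prob_at (bad l (Suc j) \<beta>) t"
      by (rule measure_pmf.finite_measure_mono) (auto simp: bad_def)
    finally show "prob_at (bad l j (\<kappa> * \<beta>)) t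
      \<le> prob_at (bad l (Suc j) \<beta>) t + 4 * measure_pmf.expectation (bind_pmf \<nu> (P t)) ?F"
      using few[of t] by simp
    show "q + 4 * (m * h\<^sup>2 / 2 + 2 * q) \<le> 9 * q + 1 / (2 * (\<kappa> * \<beta>)\<^sup>2 * m)"
      using m_pos by (simp add: h_def power2_eq_square field_simps)
  qed simp
qed

text \<open>The descent starts at \<open>j = a * l\<close>, where every petal qualifies and only a
  low core is bad. The base 10 is the 9 of \<open>bad_step\<close> plus 1 for the error newly added
  at each step.\<close>

lemma bad_iterate:
  assumes q: "ultimately_le (prob_at (low_core l)) q" and "q \<ge> 0" and "i \<le> a * l"
  shows "ultimately_le (prob_at (bad l (a * l - i) (\<kappa> ^ i))) (10 ^ i * (q + 1 / (\<kappa> ^ (2 * i) * m)))"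
  using \<open>i \<le> a * l\<close>
proof (induction i)
  case 0
  have "near l (a * l) x = B" for x
  proof -
    have "deficit (petal e) l x \<le> a * l" if "e \<in> B" for e
    proof -
      have "card (petal e) \<le> a"
        using card_N[OF that] card_mono[of "N e" "petal e"] by (simp add: petal_def)
      then show ?thesis using deficit_le[of "petal e" l x] by (meson mult_le_mono1 order_trans)
    qed
    then show ?thesis by (auto simp: near_def)
  qed
  then have "bad l (a * l) 1 = low_core l" by (simp add: bad_def m_def)
  then show ?case using q m_pos by (auto intro: ultimately_le_mono)
next
  case (Suc i)
  then have i: "Suc (a * l - Suc i) = a * l - i" by simp
  have \<kappa>i: "\<kappa> ^ i > 0" using \<kappa>_pos by simp
  let ?Q = "1 / (\<kappa> ^ (2 * i) * m)" and ?Q' = "1 / (\<kappa> ^ (2 * Suc i) * m)"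
  have "?Q \<le> ?Q'"
    using \<kappa>_pos \<kappa>_less_1 m_pos
    by (intro divide_left_mono mult_right_mono power_decreasing) auto
  have "ultimately_le (prob_at (bad l (a * l - Suc i) (\<kappa> * \<kappa> ^ i)))
    (9 * (10 ^ i * (q + ?Q)) + 1 / (2 * (\<kappa> * \<kappa> ^ i)\<^sup>2 * m))"
    by (intro bad_step \<kappa>i) (use Suc i in simp)
  moreover have "9 * (10 ^ i * (q + ?Q)) + 1 / (2 * (\<kappa> * \<kappa> ^ i)\<^sup>2 * m) \<le> 10 ^ Suc i * (q + ?Q')"
  proof -
    have half: "x / 2 \<le> 1 * (q + x)" if "0 \<le> x" for x
      using that \<open>q \<ge> 0\<close> by simp
    have Q': "0 \<le> ?Q'" using \<kappa>_pos m_pos by simp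
    have "(\<kappa> * \<kappa> ^ i)\<^sup>2 = \<kappa> ^ (2 * Suc i)"
      by (metis mult.commute power_Suc power_mult)
    then have "1 / (2 * (\<kappa> * \<kappa> ^ i)\<^sup>2 * m) = ?Q' / 2" by simp
    also have "?Q' / 2 \<le> 1 * (q + ?Q')" by (rule half[OF Q'])
    also have "\<dots> \<le> 10 ^ i * (q + ?Q')"
      using Q' \<open>q \<ge> 0\<close> by (intro mult_right_mono) auto
    finally have 1: "1 / (2 * (\<kappa> * \<kappa> ^ i)\<^sup>2 * m) \<le> 10 ^ i * (q + ?Q')" .
    have 2: "9 * (10 ^ i * (q + ?Q)) \<le> 9 * (10 ^ i * (q + ?Q'))"
      using \<open>?Q \<le> ?Q'\<close> by (intro mult_left_mono add_left_mono) auto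
    have "9 * (x * y) + x * y = 10 * x * y" for x y :: real by simp
    then show ?thesis using add_mono[OF 2 1] by (simp only: power_Suc)
  qed
  ultimately show ?case by (auto intro: ultimately_le_mono)
qed

text \<open>Outside the bad set, a positive core deficit means that some core server holds exactly
  \<open>l\<close> tasks. It is least loaded for every dispatcher whose petal is at level
  \<open>l\<close>, so at least \<open>\<beta> * m\<close> dispatchers feed it at rate
  \<open>r\<close> each. The deficit is at most \<open>a * (l + 1)\<close>, and \<open>c\<close> is
  chosen so that this constant decrease dominates \<open>c\<close> times the deficit.\<close>

lemma core_drift:
  fixes l :: nat
  assumes \<beta>: "\<beta> > 0"
  defines "c \<equiv> r * \<beta> * m / (real a * (real l + 1))"
  shows "generator (\<lambda>x. real (deficit K (Suc l) x)) x
    \<le> - c * real (deficit K (Suc l) x) + b + (r * \<beta> * m) * indicator (bad l 0 \<beta>) x"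
proof -
  let ?F = "\<lambda>x. real (deficit K (Suc l) x)"
  have w: "real a * (real l + 1) > 0" using a_pos by simp
  have c: "c > 0" using \<beta> r_pos m_pos w by (simp add: c_def)
  have mono: "?F (arrive x v) \<le> ?F x" for v using deficit_arrive_le by simp
  have "?F x \<le> real (card K * Suc l)" using deficit_le by (intro of_nat_mono)
  also have "\<dots> = real (card K) * (real l + 1)" by (simp add: algebra_simps)
  also have "\<dots> \<le> real a * (real l + 1)"
    using card_K by (intro mult_right_mono) auto
  finally have "c * ?F x \<le> c * (real a * (real l + 1))" using c by (intro mult_left_mono) auto
  then have cF: "c * ?F x \<le> r * \<beta> * m" using w a_pos by (simp add: c_def)
  have dep: "(\<Sum>v\<in>busy x. mu v * (?F (depart x v) - ?F x)) \<le> b"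
  proof -
    have "(\<Sum>v\<in>busy x. mu v * (?F (depart x v) - ?F x)) \<le> (\<Sum>v\<in>busy x. if v \<in> K then mmax else 0)"
    proof (rule sum_mono)
      fix v assume v: "v \<in> busy x"
      show "mu v * (?F (depart x v) - ?F x) \<le> (if v \<in> K then mmax else 0)"
      proof (cases "v \<in> K")
        case True
        have "?F (depart x v) - ?F x \<le> 1"
          using deficit_depart_le[OF finite_K, of "Suc l" x v] by linarith
        then have "mu v * (?F (depart x v) - ?F x) \<le> mu v * 1"
          using mu_pos v by (intro mult_left_mono) (auto simp: less_imp_le)
        then show ?thesis using True mu_K_le[of v] by simp
      next
        case False
        then have "deficit K (Suc l) (depart x v) = deficit K (Suc l) x"
          by (intro deficit_cong) auto
        then show ?thesis using False by simp
      qed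
    qed
    also have "\<dots> \<le> (\<Sum>v\<in>S. if v \<in> K then mmax else 0)"
      using mmax by (intro sum_mono2) auto
    also have "\<dots> = real (card K) * mmax"
      using K_subset by (simp add: sum.If_cases Int_absorb1)
    also have "\<dots> \<le> b" unfolding b_def using card_K mmax by (intro mult_right_mono) auto
    finally show ?thesis .
  qed
  show ?thesis
  proof (cases "x \<notin> bad l 0 \<beta> \<and> ?F x > 0")
    \<comment> \<open>Departures alone suffice here: either the indicator term covers
      \<open>c\<close> times the deficit, or the deficit is 0.\<close>
    case False
    have "generator ?F x \<le> (\<Sum>e\<in>{}. r * (?F (arrive x (least_server x e)) - ?F x)) +
      (\<Sum>v\<in>busy x. mu v * (?F (depart x v) - ?F x))"
      using r_pos by (intro generator_le mono) auto
    also have "\<dots> \<le> b" using dep by simp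
    finally have "generator ?F x \<le> b" .
    moreover have "0 \<le> - c * ?F x + (r * \<beta> * m) * indicator (bad l 0 \<beta>) x"
      using False cF by (auto simp: indicator_def)
    ultimately show ?thesis by linarith
  next
    case True
    let ?A = "near l 0 x"
    have AB: "?A \<subseteq> B" by (auto simp: near_def)
    have full: "l \<le> x v" if "v \<in> K" for v
      using True that by (auto simp: bad_def low_core_def not_less)
    have "\<exists>v\<in>K. x v < Suc l"
    proof (rule ccontr)
      assume "\<not> (\<exists>v\<in>K. x v < Suc l)"
      then have "deficit K (Suc l) x = 0" by (simp add: deficit_def not_less)
      then show False using True by simp
    qed
    then obtain v where v: "v \<in> K" "x v < Suc l" by blast
    then have xv: "x v = l" using full[of v] by simp
    have least: "x v \<le> x w" if "e \<in> ?A" "w \<in> N e" for e w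
    proof (cases "w \<in> K")
      case False
      have "(\<Sum>w\<in>petal e. l - x w) = 0" using that by (auto simp: near_def deficit_def)
      then show ?thesis using that False xv by (auto simp: petal_def sum_eq_0_iff)
    qed (use full xv in auto)
    have "?F (arrive x v) + 1 = ?F x"
      using deficit_arrive[of K v x "Suc l", OF finite_K v] by (metis of_nat_1 of_nat_add)
    then have gain: "?F (arrive x v) - ?F x = - 1" by linarith
    have "generator ?F x \<le> (\<Sum>e\<in>?A. r * (?F (arrive x v) - ?F x)) +
      (\<Sum>v\<in>busy x. mu v * (?F (depart x v) - ?F x))"
      using AB B K v(1) r_pos least
      by (intro generator_le[where least = "\<lambda>_. v"] mono r_le) auto
    also have "\<dots> \<le> - (r * real (card ?A)) + b"
      using dep unfolding gain by (simp add: mult.commute)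
    also have "\<dots> \<le> - (r * (\<beta> * m)) + b"
      using True r_pos by (auto simp: bad_def)
    also have "\<dots> \<le> - c * ?F x + b" using cF by (simp add: mult.assoc)
    finally show ?thesis using True by (simp add: indicator_def)
  qed
qed

text \<open>The deficit is an integer, so it is at least 1 whenever the core is low, and Markov's
  inequality applies with threshold 1.\<close>

lemma core_step:
  assumes \<beta>: "\<beta> > 0" and q: "ultimately_le (prob_at (bad l 0 \<beta>)) q"
  shows "ultimately_le (prob_at (low_core (Suc l))) (real a * (real l + 1) * (b / (r * \<beta> * m) + q))"
proof -
  let ?F = "\<lambda>x. real (deficit K (Suc l) x)"
  let ?c = "r * \<beta> * m / (real a * (real l + 1))"
  have F: "\<bar>?F x\<bar> \<le> real (card K * Suc l)" for x
    using deficit_le[of K "Suc l" x] by (simp flip: of_nat_mult del: mult_Suc_right)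
  have pos: "r * \<beta> * m > 0" "real a * (real l + 1) > 0" using \<beta> r_pos m_pos a_pos by auto
  have "ultimately_le (\<lambda>t. measure_pmf.expectation (bind_pmf \<nu> (P t)) ?F) ((b + (r * \<beta> * m) * q) / ?c)"
    using pos by (intro lyapunov_bound[OF F initial _ _ core_drift[OF \<beta>] q]) auto
  then show ?thesis
  proof (rule ultimately_le_mono)
    fix t :: real
    have "1 \<le> ?F x" if x: "x \<in> low_core (Suc l)" for x
    proof -
      obtain v where "v \<in> K" "x v < Suc l" using x by (auto simp: low_core_def)
      then have "deficit K (Suc l) x \<noteq> 0"
        by (auto simp: deficit_def not_le intro!: bexI[of _ v])
      then show ?thesis by linarith
    qed
    then show "prob_at (low_core (Suc l)) t \<le> measure_pmf.expectation (bind_pmf \<nu> (P t)) ?F"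
      using markov_inequality_pmf[of ?F _ 1 "low_core (Suc l)" "bind_pmf \<nu> (P t)", OF F] by simp
    show "(b + (r * \<beta> * m) * q) / ?c \<le> real a * (real l + 1) * (b / (r * \<beta> * m) + q)"
      using pos by (simp add: field_simps)
  qed
qed

end

text \<open>One round is \<open>a * l\<close> descents, ending with the fraction
  \<open>\<kappa> ^ (a * l)\<close>, followed by one core step; the common factor 1/m is taken out.
  No network occurs in it, so m can be fixed before n.\<close>

primrec core_const :: "nat \<Rightarrow> real \<Rightarrow> real \<Rightarrow> nat \<Rightarrow> real" where
  "core_const a r b 0 = 0"
| "core_const a r b (Suc l) =
    (let \<kappa> = r / (4 * (r + b)) in
      real a * (real l + 1) * (b / (r * \<kappa> ^ (a * l))
        + 10 ^ (a * l) * (core_const a r b l + 1 / \<kappa> ^ (2 * (a * l)))))"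

lemma core_const_nonneg:
  assumes "r \<ge> 0" "b \<ge> 0"
  shows "core_const a r b l \<ge> 0"
  using assms by (induction l) (auto simp: Let_def)

context sunflower_network
begin

lemma low_core_bound: "ultimately_le (prob_at (low_core l)) (core_const a r b l / m)"
proof (induction l)
  case 0
  have "low_core 0 = {}" by (auto simp: low_core_def)
  then show ?case by (simp add: ultimately_le_def)
next
  case (Suc l)
  let ?C = "core_const a r b l" and ?i = "a * l"
  have "ultimately_le (prob_at (bad l 0 (\<kappa> ^ ?i))) (10 ^ ?i * (?C / m + 1 / (\<kappa> ^ (2 * ?i) * m)))"
    using bad_iterate[OF Suc, of ?i] core_const_nonneg[of r b a l] r_pos b_pos m_pos by simp
  from core_step[OF _ this] have "ultimately_le (prob_at (low_core (Suc l)))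
     (real a * (real l + 1) * (b / (r * \<kappa> ^ ?i * m) + 10 ^ ?i * (?C / m + 1 / (\<kappa> ^ (2 * ?i) * m))))"
    using \<kappa>_pos by simp
  moreover have "b / (r * \<kappa> ^ ?i * m) + 10 ^ ?i * (?C / m + 1 / (\<kappa> ^ (2 * ?i) * m))
    = (b / (r * \<kappa> ^ ?i) + 10 ^ ?i * (?C + 1 / \<kappa> ^ (2 * ?i))) / m"
    by (simp add: add_divide_distrib distrib_left)
  moreover have "core_const a r b (Suc l)
    = real a * (real l + 1) * (b / (r * \<kappa> ^ ?i) + 10 ^ ?i * (?C + 1 / \<kappa> ^ (2 * ?i)))"
    by (simp add: Let_def \<kappa>_def)
  ultimately show ?case by (simp only: times_divide_eq_right)
qed

end

section \<open>The sunflower lemma\<close>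

text \<open>Each choice of a set rules out itself and the sets meeting it, at most
  \<open>a * R + 1\<close> in all.\<close>

lemma greedy_disjoint_family:
  fixes N :: "'d \<Rightarrow> 's set"
  assumes "finite A" and N: "\<And>e. e \<in> A \<Longrightarrow> finite (N e) \<and> card (N e) \<le> a"
    and deg: "\<And>v. card {e \<in> A. v \<in> N e} \<le> R" and "card A \<ge> m * (a * R + 1)"
  shows "\<exists>B\<subseteq>A. card B = m \<and> (\<forall>e\<in>B. \<forall>e'\<in>B. e \<noteq> e' \<longrightarrow> N e \<inter> N e' = {})"
  using assms
proof (induction m arbitrary: A)
  case 0
  then show ?case by (intro exI[of _ "{}"]) auto
next
  case (Suc m)
  then have "card A > 0" by simp
  then obtain e where e: "e \<in> A" by fastforce
  define C where "C = (\<Union>v\<in>N e. {e' \<in> A. v \<in> N e'})"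
  \<comment> \<open>\<open>e\<close> is removed explicitly, because it belongs to \<open>C\<close>
    only if \<open>N e\<close> is nonempty.\<close>
  define A' where "A' = A - insert e C"
  have finC: "finite C" using Suc.prems(1) Suc.prems(2)[OF e] by (auto simp: C_def)
  have "card C \<le> card (N e) * R"
    unfolding C_def using Suc.prems(2)[OF e] Suc.prems(3) by (intro card_UN_le_mult) auto
  also have "\<dots> \<le> a * R" using Suc.prems(2)[OF e] by simp
  finally have "card (insert e C) \<le> a * R + 1" using finC by (simp add: card_insert_if)
  moreover have "card A - card (insert e C) \<le> card A'"
    unfolding A'_def using finC by (intro diff_card_le_card_Diff) auto
  ultimately have cardA': "m * (a * R + 1) \<le> card A'" using Suc.prems(4) by simp
  have "\<exists>B\<subseteq>A'. card B = m \<and> (\<forall>e\<in>B. \<forall>e'\<in>B. e \<noteq> e' \<longrightarrow> N e \<inter> N e' = {})"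
  proof (rule Suc.IH)
    show "card {e \<in> A'. v \<in> N e} \<le> R" for v
      using Suc.prems(1) by (intro order_trans[OF card_mono Suc.prems(3)[of v]]) (auto simp: A'_def)
  qed (use Suc.prems cardA' in \<open>auto simp: A'_def\<close>)
  then obtain B where B: "B \<subseteq> A'" "card B = m" "\<forall>e\<in>B. \<forall>e'\<in>B. e \<noteq> e' \<longrightarrow> N e \<inter> N e' = {}"
    by blast
  have "finite B" using B(1) Suc.prems(1) by (auto simp: A'_def intro: finite_subset)
  moreover have "e \<notin> B" using B(1) by (auto simp: A'_def)
  moreover have "N e \<inter> N e' = {}" if "e' \<in> B" for e'
    using that B(1) by (auto simp: A'_def C_def)
  ultimately show ?case
    using B e by (intro exI[of _ "insert e B"]) (auto simp: A'_def Int_commute)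
qed

text \<open>For two or more members \<open>K\<close> is forced to be every pairwise intersection;
  for a single member it may be any subset of it.\<close>

definition sunflower :: "('d \<Rightarrow> 's set) \<Rightarrow> 'd set \<Rightarrow> 's set \<Rightarrow> bool" where
  "sunflower N B K \<longleftrightarrow> (\<forall>e\<in>B. K \<subseteq> N e) \<and>
    (\<forall>e\<in>B. \<forall>e'\<in>B. e \<noteq> e' \<longrightarrow> N e \<inter> N e' \<subseteq> K)"

text \<open>Serves to place the given server in the core, since all chosen dispatchers are
  compatible with it.\<close>

lemma sunflower_insert:
  assumes "sunflower N B K" "\<And>e. e \<in> B \<Longrightarrow> v \<in> N e"
  shows "sunflower N B (insert v K)"
  using assms unfolding sunflower_def by (meson insert_subset subset_insertI2)

lemma sunflower_remove_point:
  assumes flower: "sunflower (\<lambda>e. N e - {v}) B K" and v: "\<And>e. e \<in> B \<Longrightarrow> v \<in> N e"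
  shows "sunflower N B (insert v K)"
  unfolding sunflower_def
proof (intro conjI ballI impI)
  show "insert v K \<subseteq> N e" if "e \<in> B" for e
    using flower v that by (auto simp: sunflower_def)
  show "N e \<inter> N e' \<subseteq> insert v K" if "e \<in> B" "e' \<in> B" "e \<noteq> e'" for e e'
  proof -
    have "(N e - {v}) \<inter> (N e' - {v}) \<subseteq> K" using flower that by (simp add: sunflower_def)
    then show ?thesis by blast
  qed
qed

text \<open>Induction on the size of the sets: if a point lies in more than \<open>R\<close> of
  them, delete it there and use the hypothesis; otherwise a greedy choice finds disjoint sets. The
  family is indexed, so sets may repeat and petals may be empty, as happens when dispatchers share
  all their servers.\<close>

lemma sunflower_lemma:
  "\<exists>R. \<forall>(A :: 'd set) (N :: 'd \<Rightarrow> 's set). finite A \<longrightarrow> (\<forall>e\<in>A. finite (N e) \<and> card (N e) \<le> a) \<longrightarrow>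
    R \<le> card A \<longrightarrow> (\<exists>B K. B \<subseteq> A \<and> card B = m \<and> sunflower N B K)"
proof (induction a)
  case 0
  show ?case
  proof (rule exI[of _ m], intro allI impI)
    fix A :: "'d set" and N :: "'d \<Rightarrow> 's set"
    assume A: "finite A" "\<forall>e\<in>A. finite (N e) \<and> card (N e) \<le> 0" "m \<le> card A"
    obtain B where "B \<subseteq> A" "card B = m" using obtain_subset_with_card_n[OF A(3)] by blast
    moreover have "N e = {}" if "e \<in> A" for e using A(2) that by auto
    ultimately show "\<exists>B K. B \<subseteq> A \<and> card B = m \<and> sunflower N B K"
      by (intro exI[of _ B] exI[of _ "{}"]) (auto simp: sunflower_def)
  qed
next
  case (Suc a)
  then obtain R where R: "\<forall>(A :: 'd set) (N :: 'd \<Rightarrow> 's set). finite A \<longrightarrow>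
    (\<forall>e\<in>A. finite (N e) \<and> card (N e) \<le> a) \<longrightarrow> R \<le> card A \<longrightarrow>
    (\<exists>B K. B \<subseteq> A \<and> card B = m \<and> sunflower N B K)" by (elim exE)
  show ?case
  proof (rule exI[of _ "m * (Suc a * R + 1)"], intro allI impI)
    fix A :: "'d set" and N :: "'d \<Rightarrow> 's set"
    assume A: "finite A" "\<forall>e\<in>A. finite (N e) \<and> card (N e) \<le> Suc a" "m * (Suc a * R + 1) \<le> card A"
    show "\<exists>B K. B \<subseteq> A \<and> card B = m \<and> sunflower N B K"
    proof (cases "\<exists>v. card {e \<in> A. v \<in> N e} > R")
      case True
      then obtain v where v: "card {e \<in> A. v \<in> N e} > R" by blast
      have "\<exists>B K. B \<subseteq> {e \<in> A. v \<in> N e} \<and> card B = m \<and> sunflower (\<lambda>e. N e - {v}) B K"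
        using A v by (intro R[rule_format]) auto
      then obtain B K where BK: "B \<subseteq> {e \<in> A. v \<in> N e}" "card B = m"
        "sunflower (\<lambda>e. N e - {v}) B K" by blast
      then have "sunflower N B (insert v K)" by (intro sunflower_remove_point) auto
      with BK show ?thesis by blast
    next
      case False
      then have "\<exists>B\<subseteq>A. card B = m \<and> (\<forall>e\<in>B. \<forall>e'\<in>B. e \<noteq> e' \<longrightarrow> N e \<inter> N e' = {})"
        using A by (intro greedy_disjoint_family[where a = "Suc a" and R = R]) (auto simp: not_less)
      then obtain B where "B \<subseteq> A" "card B = m" "\<forall>e\<in>B. \<forall>e'\<in>B. e \<noteq> e' \<longrightarrow> N e \<inter> N e' = {}" by blast
      then show ?thesis by (intro exI[of _ B] exI[of _ "{}"]) (auto simp: sunflower_def)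
    qed
  qed
qed

section \<open>Long-run occupancies\<close>

text \<open>Conditioning on the state at time 0 and summing over the countably many initial states
  turns the chain into an initial pmf followed by the semigroup, so the drift estimates apply to
  it.\<close>

lemma markov_chain_law:
  fixes X :: "real \<Rightarrow> 'w \<Rightarrow> 'x"
  assumes chain: "markov_chain I q M X" and I: "countable I"
  obtains P \<nu> where "transition_function I P" "has_transition_rates I P q" "set_pmf \<nu> \<subseteq> I"
    "\<And>t A. t \<ge> 0 \<Longrightarrow> \<P>(\<omega> in M. X t \<omega> \<in> A) = measure_pmf.prob (bind_pmf \<nu> (P t)) A"
proof -
  interpret prob_space M using chain by (simp add: markov_chain_def)
  have X: "X t \<in> measurable M (count_space I)" if "t \<ge> 0" for t
    using chain that by (simp add: markov_chain_def)
  from chain have "\<exists>P. transition_function I P \<and> has_transition_rates I P q \<and>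
    (\<forall>s \<ge> 0. \<forall>t \<ge> 0. \<forall>J x. \<forall>y \<in> I. finite J \<longrightarrow> J \<subseteq> {0..s} \<longrightarrow> s \<in> J \<longrightarrow>
      \<P>(\<omega> in M. \<forall>r \<in> J. X r \<omega> = x r) > 0 \<longrightarrow>
      \<P>(\<omega> in M. X (s + t) \<omega> = y \<bar> \<forall>r \<in> J. X r \<omega> = x r) = pmf (P t (x s)) y)"
    unfolding markov_chain_def by (elim conjE)
  then obtain P where P: "transition_function I P" "has_transition_rates I P q"
    and markov: "\<forall>s \<ge> 0. \<forall>t \<ge> 0. \<forall>J x. \<forall>y \<in> I. finite J \<longrightarrow> J \<subseteq> {0..s} \<longrightarrow> s \<in> J \<longrightarrow>
      \<P>(\<omega> in M. \<forall>r \<in> J. X r \<omega> = x r) > 0 \<longrightarrow>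
      \<P>(\<omega> in M. X (s + t) \<omega> = y \<bar> \<forall>r \<in> J. X r \<omega> = x r) = pmf (P t (x s)) y"
    by (elim exE conjE)
  have cond: "\<P>(\<omega> in M. X t \<omega> = y \<bar> X 0 \<omega> = x) = pmf (P t x) y"
    if "t \<ge> 0" "y \<in> I" "\<P>(\<omega> in M. X 0 \<omega> = x) > 0" for t x y
    using markov[rule_format, where s = 0 and t = t and y = y and J = "{0}" and x = "\<lambda>_. x"] that
    by simp
  have X': "X t \<in> measurable M (count_space UNIV)" if "t \<ge> 0" for t
    using measurable_compose[OF X[OF that], of "\<lambda>x. x" "count_space UNIV"] by simp
  have inI: "X t \<omega> \<in> I" if "t \<ge> 0" "\<omega> \<in> space M" for t \<omega>
    using measurable_space[OF X[OF that(1)] that(2)] by simp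
  have eq_sets: "{\<omega> \<in> space M. X t \<omega> = x} \<in> sets M" if "t \<ge> 0" for t x
    using measurable_sets[OF X'[OF that], of "{x}"] by (simp add: vimage_def Int_def conj_commute)
  define law where "law t x = \<P>(\<omega> in M. X t \<omega> = x)" for t x
  have law_outside: "law t x = 0" if "t \<ge> 0" "x \<notin> I" for t x
  proof -
    have empty: "{\<omega> \<in> space M. X t \<omega> = x} = {}" using inI[OF that(1)] that(2) by auto
    show ?thesis unfolding law_def empty by simp
  qed
  \<comment> \<open>With \<open>A = UNIV\<close> this gives the total mass 1 that
    \<open>embed_pmf\<close> demands; general \<open>A\<close> recovers the distribution from the
    point probabilities.\<close>
  have law_total: "(\<integral>\<^sup>+x. ennreal (law t x) * indicator A x \<partial>count_space UNIV)
    = emeasure M {\<omega> \<in> space M. X t \<omega> \<in> A}" if t: "t \<ge> 0" for t A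
  proof -
    have "(\<integral>\<^sup>+x. ennreal (law t x) * indicator A x \<partial>count_space UNIV)
      = (\<integral>\<^sup>+x. emeasure M {\<omega> \<in> space M. X t \<omega> = x} \<partial>count_space (A \<inter> I))"
      unfolding nn_integral_count_space_indicator[of "A \<inter> I", simplified]
    proof (intro nn_integral_cong)
      fix x
      show "ennreal (law t x) * indicator A x
        = emeasure M {\<omega> \<in> space M. X t \<omega> = x} * indicator (A \<inter> I) x"
        using law_outside[OF t, of x]
        by (cases "x \<in> I") (auto simp: law_def emeasure_eq_measure indicator_def)
    qed
    also have "\<dots> = emeasure M (\<Union>x\<in>A \<inter> I. {\<omega> \<in> space M. X t \<omega> = x})"
      using I t by (intro emeasure_UN_countable[symmetric] eq_sets)
        (auto simp: disjoint_family_on_def)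
    also have "(\<Union>x\<in>A \<inter> I. {\<omega> \<in> space M. X t \<omega> = x}) = {\<omega> \<in> space M. X t \<omega> \<in> A}"
      using inI[OF t] by auto
    finally show ?thesis .
  qed
  define \<nu> where "\<nu> = embed_pmf (law 0)"
  have "(\<integral>\<^sup>+x. ennreal (law 0 x) \<partial>count_space UNIV) = 1"
    using law_total[of 0 UNIV] emeasure_space_1 by simp
  then have pmf\<nu>: "pmf \<nu> x = law 0 x" for x
    unfolding \<nu>_def by (intro pmf_embed_pmf) (auto simp: law_def)
  have set\<nu>: "set_pmf \<nu> \<subseteq> I"
  proof
    fix x assume "x \<in> set_pmf \<nu>"
    then have "law 0 x \<noteq> 0" by (simp add: set_pmf_iff pmf\<nu>)
    then show "x \<in> I" using law_outside[of 0 x] by blast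
  qed
  have law_t: "law t y = pmf (bind_pmf \<nu> (P t)) y" if t: "t \<ge> 0" for t y
  proof (cases "y \<in> I")
    case True
    \<comment> \<open>Initial states of probability 0 escape the conditional formula, but there both
      sides vanish.\<close>
    have joint: "\<P>(\<omega> in M. X 0 \<omega> = x \<and> X t \<omega> = y) = law 0 x * pmf (P t x) y" for x
    proof (cases "law 0 x > 0")
      case True
      have "\<P>(\<omega> in M. X t \<omega> = y \<bar> X 0 \<omega> = x) = pmf (P t x) y"
        using \<open>y \<in> I\<close> t True by (intro cond) (auto simp: law_def)
      then show ?thesis using True
        by (simp add: cond_prob_def law_def conj_commute field_simps)
    next
      case False
      then have 0: "law 0 x = 0" by (simp add: law_def not_less measure_le_0_iff)
      have "\<P>(\<omega> in M. X 0 \<omega> = x \<and> X t \<omega> = y) \<le> law 0 x"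
        unfolding law_def by (intro finite_measure_mono eq_sets) auto
      then show ?thesis using 0 by (simp add: measure_le_0_iff)
    qed
    have "ennreal (law t y) = emeasure M {\<omega> \<in> space M. X t \<omega> = y}"
      by (simp add: law_def emeasure_eq_measure)
    also have "\<dots> = emeasure M (\<Union>x\<in>I. {\<omega> \<in> space M. X 0 \<omega> = x \<and> X t \<omega> = y})"
      using inI[of 0] by (intro arg_cong[where f = "emeasure M"]) auto
    also have "\<dots> = (\<integral>\<^sup>+x. emeasure M {\<omega> \<in> space M. X 0 \<omega> = x \<and> X t \<omega> = y} \<partial>count_space I)"
    proof (intro emeasure_UN_countable I)
      show "{\<omega> \<in> space M. X 0 \<omega> = x \<and> X t \<omega> = y} \<in> sets M" for x
        using sets.Int[OF eq_sets[of 0 x] eq_sets[OF t, of y]]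
        by (simp add: Int_def conj_ac cong: conj_cong)
    qed (auto simp: disjoint_family_on_def)
    also have "\<dots> = (\<integral>\<^sup>+x. ennreal (law 0 x * pmf (P t x) y) \<partial>count_space I)"
      by (simp add: emeasure_eq_measure joint)
    also have "\<dots> = (\<integral>\<^sup>+x. ennreal (pmf \<nu> x) * ennreal (pmf (P t x) y) \<partial>count_space UNIV)"
      unfolding nn_integral_count_space_indicator[of I, simplified]
    proof (intro nn_integral_cong)
      fix x
      have "pmf \<nu> x = 0" if "x \<notin> I" using set\<nu> that by (auto simp: set_pmf_iff)
      then show "ennreal (law 0 x * pmf (P t x) y) * indicator I x
        = ennreal (pmf \<nu> x) * ennreal (pmf (P t x) y)"
        by (cases "x \<in> I") (auto simp: pmf\<nu>[symmetric] ennreal_mult)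
    qed
    also have "\<dots> = ennreal (pmf (bind_pmf \<nu> (P t)) y)"
      by (simp add: ennreal_pmf_bind nn_integral_measure_pmf)
    finally show ?thesis by (simp add: law_def)
  next
    case False
    have "set_pmf (P t x) \<subseteq> I" if "x \<in> set_pmf \<nu>" for x
      using set\<nu> P(1) t that unfolding transition_function_def by blast
    then have "y \<notin> set_pmf (bind_pmf \<nu> (P t))" using False by auto
    then show ?thesis using law_outside[OF t False] by (simp add: set_pmf_iff del: set_bind_pmf)
  qed
  have "\<P>(\<omega> in M. X t \<omega> \<in> A) = measure_pmf.prob (bind_pmf \<nu> (P t)) A" if t: "t \<ge> 0" for t A
  proof -
    have "ennreal (\<P>(\<omega> in M. X t \<omega> \<in> A)) = (\<integral>\<^sup>+x. ennreal (law t x) * indicator A x \<partial>count_space UNIV)"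
      by (simp add: law_total[OF t] emeasure_eq_measure)
    also have "\<dots> = (\<integral>\<^sup>+x. indicator A x \<partial>measure_pmf (bind_pmf \<nu> (P t)))"
      by (simp add: nn_integral_measure_pmf law_t[OF t] del: nn_integral_indicator nn_integral_bind_pmf)
    also have "\<dots> = ennreal (measure_pmf.prob (bind_pmf \<nu> (P t)) A)"
      by (simp add: measure_pmf.emeasure_eq_measure del: nn_integral_bind_pmf)
    finally show ?thesis by simp
  qed
  then show thesis using that[OF P set\<nu>] by blast
qed

text \<open>The network enters the bound only through \<open>card B\<close>, which gives uniformity
  in n.\<close>

lemma occupancy_low_bound:
  fixes k :: nat and D :: "'d set" and S :: "'s set" and X :: "real \<Rightarrow> 'w \<Rightarrow> 's \<Rightarrow> nat"
  assumes "d \<ge> 1" "network D S E" "\<And>e. e \<in> D \<Longrightarrow> lam e > 0" "\<And>v. v \<in> S \<Longrightarrow> mu v > 0"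
    and occ: "power_of_d_occupancy d D S E lam mu M X"
    and "lmin > 0" "mmax > 0"
    and B: "B \<subseteq> skewed_dispatchers_of E lam mu a lmin mmax u" "finite B" "B \<noteq> {}"
    and u: "u \<in> K" and flower: "sunflower (servers_of E) B K"
  defines "C \<equiv> core_const a (lmin / (real a * 2 ^ a)) (real a * mmax) k"
  shows "ultimately_le (\<lambda>t. \<P>(\<omega> in M. X t \<omega> u < k)) (C / real (card B))"
proof -
  have "finite S" using assms(2) by (simp add: network_def)
  then have "countable (S \<rightarrow>\<^sub>E (UNIV :: nat set))" by (intro countable_PiE) auto
  then obtain P \<nu> where P: "transition_function (S \<rightarrow>\<^sub>E UNIV) P"
    "has_transition_rates (S \<rightarrow>\<^sub>E UNIV) P (occupancy_rate d D S E lam mu)" "set_pmf \<nu> \<subseteq> S \<rightarrow>\<^sub>E UNIV"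
    and law: "\<And>t A. t \<ge> 0 \<Longrightarrow> \<P>(\<omega> in M. X t \<omega> \<in> A) = measure_pmf.prob (bind_pmf \<nu> (P t)) A"
    using occ unfolding power_of_d_occupancy_def by (elim markov_chain_law) blast+
  have BD: "B \<subseteq> D"
    using B(1) assms(2) by (auto simp: skewed_dispatchers_of_def dispatchers_of_def network_def)
  interpret sunflower_network d D S E lam mu P a lmin mmax B K \<nu>
  proof
    show "K \<noteq> {}" using u by auto
    show "K \<subseteq> servers_of E e" if "e \<in> B" for e using flower that by (auto simp: sunflower_def)
    show "servers_of E e \<inter> servers_of E e' \<subseteq> K" if "e \<in> B" "e' \<in> B" "e \<noteq> e'" for e e'
      using flower that by (simp add: sunflower_def)
  qed (use assms P BD in \<open>auto simp: skewed_dispatchers_of_def\<close>)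
  show ?thesis
  proof (rule ultimately_le_mono[OF low_core_bound[of k]])
    fix t :: real assume t: "t \<ge> 0"
    have "\<P>(\<omega> in M. X t \<omega> u < k) = prob_at {x. x u < k} t" using law[OF t, of "{x. x u < k}"] by simp
    also have "\<dots> \<le> prob_at (low_core k) t"
      using u by (intro measure_pmf.finite_measure_mono) (auto simp: low_core_def)
    finally show "\<P>(\<omega> in M. X t \<omega> u < k) \<le> prob_at (low_core k) t" .
  qed (simp add: C_def r_def b_def m_def)
qed

theorem corollary1:
  fixes d :: nat
    and D :: "nat \<Rightarrow> 'd set" and S :: "nat \<Rightarrow> 's set" and E :: "nat \<Rightarrow> ('d \<times> 's) set"
    and lam :: "nat \<Rightarrow> 'd \<Rightarrow> real" and mu :: "nat \<Rightarrow> 's \<Rightarrow> real"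
    and M :: "nat \<Rightarrow> 'w measure" and X :: "nat \<Rightarrow> real \<Rightarrow> 'w \<Rightarrow> 's \<Rightarrow> nat"
    and u :: "nat \<Rightarrow> 's" and a :: nat and lmin mmax :: real
  assumes "d \<ge> 1"
    and "\<And>n. n \<ge> 1 \<Longrightarrow> network (D n) (S n) (E n)"
    and "\<And>n e. n \<ge> 1 \<Longrightarrow> e \<in> D n \<Longrightarrow> lam n e > 0"
    and "\<And>n v. n \<ge> 1 \<Longrightarrow> v \<in> S n \<Longrightarrow> mu n v > 0"
    and "\<And>n. n \<ge> 1 \<Longrightarrow> power_of_d_occupancy d (D n) (S n) (E n) (lam n) (mu n) (M n) (X n)"
    and "\<And>n. n \<ge> 1 \<Longrightarrow> u n \<in> S n"
    and "lmin > 0" and "mmax > 0"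
    and "filterlim (\<lambda>n. card (skewed_dispatchers_of (E n) (lam n) (mu n) a lmin mmax (u n)))
           at_top sequentially"
  shows "\<forall>k :: nat.
    (\<lambda>n. Liminf at_top (\<lambda>t :: real. ereal (\<P>(\<omega> in M n. X n t \<omega> (u n) \<ge> k)))) \<longlonglongrightarrow> 1"
proof
  fix k :: nat
  define L where "L n = Liminf at_top (\<lambda>t :: real. ereal (\<P>(\<omega> in M n. X n t \<omega> (u n) \<ge> k)))" for n
  define C where "C = core_const a (lmin / (real a * 2 ^ a)) (real a * mmax) k"
  have "C \<ge> 0" unfolding C_def using \<open>lmin > 0\<close> \<open>mmax > 0\<close> by (intro core_const_nonneg) auto
  have prob: "prob_space (M n)" "t \<ge> 0 \<Longrightarrow> X n t \<in> measurable (M n) (count_space (S n \<rightarrow>\<^sub>E UNIV))"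
    if "n \<ge> 1" for n t
    using assms(5)[OF that] by (auto simp: power_of_d_occupancy_def markov_chain_def)
  have "L n \<le> 1" if "n \<ge> 1" for n
  proof -
    interpret prob_space "M n" using prob that by simp
    have "L n \<le> Liminf at_top (\<lambda>t :: real. 1)"
      unfolding L_def by (intro Liminf_mono always_eventually) simp
    then show ?thesis by (simp add: Liminf_const)
  qed
  then have upper: "\<forall>\<^sub>F n in sequentially. L n \<le> 1"
    by (auto simp: eventually_sequentially)
  have lower: "\<forall>\<^sub>F n in sequentially. ereal (1 - \<epsilon>) \<le> L n" if \<epsilon>: "\<epsilon> > 0" for \<epsilon>
  proof -
    \<comment> \<open>Half of \<open>\<epsilon>\<close> goes to \<open>C / m\<close>, the other half
      to the slack in \<open>ultimately_le\<close>; the maximum with 1 keeps the sunflower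
      nonempty.\<close>
    obtain m0 :: nat where "real m0 > 2 * C / \<epsilon>" using reals_Archimedean2 by blast
    define m where "m = max m0 1"
    have m: "m \<ge> 1" "C / real m \<le> \<epsilon> / 2"
    proof -
      have "2 * C / \<epsilon> \<le> real m" using \<open>real m0 > _\<close> by (simp add: m_def)
      then show "C / real m \<le> \<epsilon> / 2" using \<epsilon> by (simp add: m_def field_simps)
    qed (simp add: m_def)
    \<comment> \<open>\<open>R\<close> depends on \<open>a\<close> and \<open>m\<close> only, so
      growth of the skewed neighborhoods makes it available for all large n.\<close>
    obtain R where R: "\<forall>(A :: 'd set) (N :: 'd \<Rightarrow> 's set). finite A \<longrightarrow>
      (\<forall>e\<in>A. finite (N e) \<and> card (N e) \<le> a) \<longrightarrow> R \<le> card A \<longrightarrow>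
      (\<exists>B K. B \<subseteq> A \<and> card B = m \<and> sunflower N B K)"
      using sunflower_lemma[of a m] by (elim exE)
    have "\<forall>\<^sub>F n in sequentially. R \<le> card (skewed_dispatchers_of (E n) (lam n) (mu n) a lmin mmax (u n))"
      using assms(9) by (auto simp: filterlim_at_top)
    then show ?thesis
      using eventually_ge_at_top[of 1]
    proof eventually_elim
      fix n :: nat
      let ?A = "skewed_dispatchers_of (E n) (lam n) (mu n) a lmin mmax (u n)"
      assume n: "R \<le> card ?A" "1 \<le> n"
      interpret prob_space "M n" using prob n by simp
      have net: "finite (D n)" "finite (S n)" "E n \<subseteq> D n \<times> S n"
        using assms(2)[OF n(2)] by (auto simp: network_def)
      have "finite ?A"
        using net by (auto simp: skewed_dispatchers_of_def dispatchers_of_def intro: finite_subset[of _ "D n"])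
      moreover have "\<forall>e\<in>?A. finite (servers_of (E n) e) \<and> card (servers_of (E n) e) \<le> a"
        using net by (auto simp: skewed_dispatchers_of_def servers_of_def intro: finite_subset[of _ "S n"])
      ultimately have "\<exists>B K. B \<subseteq> ?A \<and> card B = m \<and> sunflower (servers_of (E n)) B K"
        using n(1) by (intro R[rule_format]) auto
      then obtain B K where BK: "B \<subseteq> ?A" "card B = m" "sunflower (servers_of (E n)) B K" by blast
      have "ultimately_le (\<lambda>t. prob {\<omega> \<in> space (M n). X n t \<omega> (u n) < k}) (C / real (card B))"
        unfolding C_def
      proof (rule occupancy_low_bound[OF assms(1) assms(2)[OF n(2)] assms(3)[OF n(2)]
            assms(4)[OF n(2)] assms(5)[OF n(2)] assms(7,8) BK(1)])
        show "finite B" "B \<noteq> {}" using BK(2) m by (auto intro: card_ge_0_finite)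
        have "u n \<in> servers_of (E n) e" if "e \<in> B" for e
          using that BK(1) by (auto simp: skewed_dispatchers_of_def dispatchers_of_def servers_of_def)
        then show "sunflower (servers_of (E n)) B (insert (u n) K)"
          by (rule sunflower_insert[OF BK(3)])
      qed auto
      then have "\<forall>\<^sub>F t in at_top. prob {\<omega> \<in> space (M n). X n t \<omega> (u n) < k} \<le> C / real m + \<epsilon> / 2"
        using \<epsilon> BK(2) by (simp add: ultimately_le_def)
      then have "\<forall>\<^sub>F t in at_top. ereal (1 - \<epsilon>) \<le> ereal (prob {\<omega> \<in> space (M n). X n t \<omega> (u n) \<ge> k})"
        using eventually_ge_at_top[of 0]
      proof eventually_elim
        fix t :: real
        assume t: "prob {\<omega> \<in> space (M n). X n t \<omega> (u n) < k} \<le> C / real m + \<epsilon> / 2" "0 \<le> t"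
        have "{\<omega> \<in> space (M n). X n t \<omega> (u n) < k} \<in> events"
          using measurable_compose[OF prob(2)[OF n(2) t(2)], of "\<lambda>x. x (u n)" "count_space UNIV"]
          by (simp add: measurable_sets[of _ _ "count_space UNIV" "{..<k}", simplified vimage_def Int_def])
        then have "prob {\<omega> \<in> space (M n). \<not> X n t \<omega> (u n) < k} = 1 - prob {\<omega> \<in> space (M n). X n t \<omega> (u n) < k}"
          by (rule prob_neg)
        moreover have "prob {\<omega> \<in> space (M n). X n t \<omega> (u n) < k} \<le> \<epsilon>"
          using t(1) m(2) by linarith
        ultimately show "ereal (1 - \<epsilon>) \<le> ereal (prob {\<omega> \<in> space (M n). X n t \<omega> (u n) \<ge> k})"
          by (simp add: not_less)
      qed
      then show "ereal (1 - \<epsilon>) \<le> L n" unfolding L_def by (rule Liminf_bounded)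
    qed
  qed
  have "L \<longlonglongrightarrow> 1"
  proof (rule order_tendstoI)
    fix y :: ereal assume "y < 1"
    then obtain z where z: "y < ereal z" "ereal z < 1"
      using ereal_dense2[OF \<open>y < 1\<close>] by blast
    then have "\<forall>\<^sub>F n in sequentially. ereal (1 - (1 - z)) \<le> L n" by (intro lower) simp
    then show "\<forall>\<^sub>F n in sequentially. y < L n"
      by eventually_elim (use z in \<open>auto intro: less_le_trans\<close>)
  next
    fix y :: ereal assume "1 < y"
    then show "\<forall>\<^sub>F n in sequentially. L n < y"
      using upper by (auto elim!: eventually_mono)
  qed
  then show "(\<lambda>n. Liminf at_top (\<lambda>t :: real. ereal (\<P>(\<omega> in M n. X n t \<omega> (u n) \<ge> k)))) \<longlonglongrightarrow> 1"
    unfolding L_def[abs_def] .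
qed

end
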